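(* Let $G$ be a non-discrete Hausdorff topological group. Then $G$ is amenable if and only if $$\sup_{E\in\mathcal{F}(G)}\ \sup_{\mathcal{U}\in\mathcal{N}(G_r)}\ \inf\left\{\frac{N\left(\bigvee_{g\in E}g(\mathcal{V})\right)}{N(\mathcal{V})}\ \middle|\ \mathcal{V}\in\mathcal{N}(G_r),\ \mathcal{U}\preceq\mathcal{V}\right\}=1.$$
   Context: Set notation: $\mathcal{P}(G)$ is the power set of $G$ and $\mathcal{F}(G)$ the set of finite subsets of $G$. For $\mathcal{U},\mathcal{V}\subseteq\mathcal{P}(G)$, write $\mathcal{U}\preceq\mathcal{V}$ ("$\mathcal{V}$ refines $\mathcal{U}$") if every $V\in\mathcal{V}$ is contained in some $U\in\mathcal{U}$. For a family $(\mathcal{U}_i)_{i\in I}$ of subsets of $\mathcal{P}(G)$, $\bigvee_{i\in I}\mathcal{U}_i=\{\bigcap_{i\in I}U_i\mid (U_i)_{i\in I}\in\prod_{i\in I}\mathcal{U}_i\}$ (the empty intersection being $G$). For $g\in G$, $g(\mathcal{V})=\{gV\mid V\in\mathcal{V}\}$. Right uniformity: for a topological group $G$, $G_r$ denotes $G$ regarded as a uniform space whose uniform coverings are exactly those $\mathcal{U}\subseteq\mathcal{P}(G)$ for which there is a neighborhood $V$ of the neutral element with $\mathcal{U}\preceq\{Vx\mid x\in G\}$. $\mathcal{N}(G_r)$ is the set of finite uniform coverings of $G_r$. A function $f\colon G\to\mathbb{R}$ is uniformly continuous on $G_r$ if $\{f^{-1}(U)\mid U\in\mathcal{U}\}$ is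 a uniform covering of $G_r$ for each uniform covering $\mathcal{U}$ of $\mathbb{R}$ (i.e. each $\mathcal{U}\subseteq\mathcal{P}(\mathbb{R})$ refined by the set of all open balls of some radius $r>0$). $UC_b(G_r)$ is the space of bounded uniformly continuous functions $G_r\to\mathbb{R}$. Amenability: for $g\in G$ let $\lambda_G(g)\colon G\to G$, $x\mapsto gx$. $G$ is amenable if there is a linear map $m\colon UC_b(G_r)\to\mathbb{R}$ with $\inf_{x\in G} f(x)\leq m(f)\leq\sup_{x\in G} f(x)$ and $m(f\circ\lambda_G(g))=m(f)$ for all $f\in UC_b(G_r)$ and $g\in G$. Uniform complexity: for $\mathcal{U}\in\mathcal{N}(G_r)$, $N(\mathcal{U})=\inf\{|\mathcal{V}|\mid\mathcal{V}\in\mathcal{N}(G_r),\ \mathcal{U}\preceq\mathcal{V}\}$. *)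

theory Defs
  imports "HOL-Analysis.Analysis"
begin

text \<open>
  A topological group is a type of class \<open>topological_group_add\<close>. This class does not assume
  commutativity: \<open>x + y\<close>, \<open>- x\<close> and \<open>0\<close> stand for the product, the inverse and the neutral
  element of an arbitrary, possibly non-abelian, topological group, and the order of the
  summands matters below.
\<close>

definition refined_by :: "'a set set \<Rightarrow> 'a set set \<Rightarrow> bool" (infix \<open>\<preceq>\<close> 50) where
  "\<U> \<preceq> \<V> \<longleftrightarrow> (\<forall>V\<in>\<V>. \<exists>U\<in>\<U>. V \<subseteq> U)"

text \<open>For an empty index set this is \<open>{UNIV}\<close>.\<close>
definition coverings_join :: "'i set \<Rightarrow> ('i \<Rightarrow> 'a set set) \<Rightarrow> 'a set set" where
  "coverings_join I \<U> = {\<Inter>i\<in>I. U i | U. \<forall>i\<in>I. U i \<in> \<U> i}"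

definition left_translate :: "'a::group_add \<Rightarrow> 'a set set \<Rightarrow> 'a set set" where
  "left_translate g \<V> = {(\<lambda>x. g + x) ` V | V. V \<in> \<V>}"

text \<open>The right translates \<open>V x\<close> generate the right uniformity.\<close>
definition right_uniform_covering :: "'a::topological_group_add set set \<Rightarrow> bool" where
  "right_uniform_covering \<U> \<longleftrightarrow>
     (\<exists>V. 0 \<in> interior V \<and> \<U> \<preceq> {(\<lambda>v. v + x) ` V | x. x \<in> UNIV})"

definition finite_right_uniform_coverings :: "'a::topological_group_add set set set" where
  "finite_right_uniform_coverings = {\<U>. finite \<U> \<and> right_uniform_covering \<U>}"

definition real_uniform_covering :: "real set set \<Rightarrow> bool" where
  "real_uniform_covering \<U> \<longleftrightarrow> (\<exists>r>0. \<U> \<preceq> {ball x r | x. x \<in> UNIV})"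

definition right_uniformly_continuous :: "('a::topological_group_add \<Rightarrow> real) \<Rightarrow> bool" where
  "right_uniformly_continuous f \<longleftrightarrow>
     (\<forall>\<U>. real_uniform_covering \<U> \<longrightarrow> right_uniform_covering {f -` U | U. U \<in> \<U>})"

definition UC_b :: "('a::topological_group_add \<Rightarrow> real) set" where
  "UC_b = {f. bounded (range f) \<and> right_uniformly_continuous f}"

text \<open>
  The mean \<open>m\<close> is a total function on \<open>'a \<Rightarrow> real\<close>; only its values on the linear subspace
  \<open>UC_b\<close> are constrained, so it represents a linear functional on \<open>UC_b\<close>.
  The predicate takes the group in the form of its type.
\<close>
definition amenable_group :: "'a::topological_group_add itself \<Rightarrow> bool" where
  "amenable_group _ \<longleftrightarrow>
     (\<exists>m :: ('a \<Rightarrow> real) \<Rightarrow> real.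
        (\<forall>f\<in>UC_b. \<forall>h\<in>UC_b. m (\<lambda>x. f x + h x) = m f + m h) \<and>
        (\<forall>c. \<forall>f\<in>UC_b. m (\<lambda>x. c * f x) = c * m f) \<and>
        (\<forall>f\<in>UC_b. (INF x. f x) \<le> m f \<and> m f \<le> (SUP x. f x)) \<and>
        (\<forall>f\<in>UC_b. \<forall>g. m (f \<circ> (\<lambda>x. g + x)) = m f))"

definition uniform_complexity :: "'a::topological_group_add set set \<Rightarrow> nat" where
  "uniform_complexity \<U> = Inf {card \<V> | \<V>. \<V> \<in> finite_right_uniform_coverings \<and> \<U> \<preceq> \<V>}"

end

theory Submission
  imports Defs
begin

text \<open>
  For \<open>E = {0}\<close> all quotients of complexities are \<open>1\<close>, so the supremum is at least \<open>1\<close>. The theorem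
  therefore says that amenability is equivalent to the following condition. For all \<open>E\<close>, \<open>\<U>\<close> and
  \<open>\<epsilon> > 0\<close> some finite uniform \<open>\<V>\<close> refining \<open>\<U>\<close> has a join \<open>\<J>\<close> of translates \<open>g \<V>\<close>, \<open>g \<in> E\<close>,
  whose complexity is at most \<open>1 + \<epsilon>\<close> times that of \<open>\<V>\<close>.

  From means to coverings. Let \<open>(f U)\<close> be a partition of unity subordinate to the join of the \<open>g \<U>\<close>,
  and let \<open>m\<close> be an invariant mean. Expanding \<open>1 = (\<Prod>g\<in>E. \<Sum>U. f U (g + x))\<close> and applying \<open>m\<close>
  gives a finite probability distribution on selections \<open>\<sigma>\<close> of a member \<open>\<sigma> g\<close> for each \<open>g\<close>; by
  invariance its marginal at \<open>g\<close>, namely \<open>U \<mapsto> m (f U)\<close>, is the same for all \<open>g\<close>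
  (\<open>amenable_marginals\<close>). Nonempty open sets being infinite, a large finite set \<open>F\<close> can realise this
  distribution up to a bounded error, with all translates \<open>g F\<close> disjoint. As the marginals agree,
  the points of the \<open>g F\<close> can be grouped into about \<open>|F|\<close> sets, each inside one member \<open>U\<close> of the join
  and with at most one point in each \<open>g F\<close>. Now let \<open>\<V>\<close> consist of the members of \<open>\<U>\<close> deprived of all
  points of \<open>F\<close> but one. Every uniform refinement of \<open>\<V>\<close> needs a separate member for each point of \<open>F\<close>, so
  the complexity of \<open>\<V>\<close> is at least \<open>|F|\<close>; but the join of the \<open>g \<V>\<close> is refined by one
  set for each of the groups and boundedly many others (\<open>amenable_imp_separated_set\<close>).

  From coverings to means. Let \<open>X\<close> be a smallest uniform refinement of the join of the \<open>g \<V>\<close>, and choose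
  a point \<open>x w\<close> in every \<open>w \<in> X\<close>. For each \<open>g \<in> E\<close> the set \<open>w\<close> lies in some \<open>g V\<close>, and for fixed \<open>g\<close>
  these \<open>V\<close> form a uniform covering. If part of the covering belonging to \<open>g\<close> is exchanged for sets
  of the covering belonging to \<open>h\<close> that include all those meeting it, the result is again a uniform
  covering by members of \<open>\<V>\<close>, whose number is at least the complexity of \<open>\<V>\<close>. So, for a function
  varying little on the members of \<open>\<V>\<close>, the values at the points \<open>- g + x w\<close> and at the points
  \<open>- h + x w\<close> have nearly the same distribution, and averaging over \<open>w \<in> X\<close> is nearly invariant
  (\<open>almost_invariant_of_small_ratio\<close>). A compactness argument yields an invariant mean.
\<close>

section \<open>Finite uniform coverings and their complexity\<close>

lemma right_uniform_covering_iff: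
  "right_uniform_covering \<U> \<longleftrightarrow> (\<exists>W. open W \<and> 0 \<in> W \<and> (\<forall>x. \<exists>U\<in>\<U>. \<forall>w\<in>W. w + x \<in> U))"
  (is "?L \<longleftrightarrow> ?R")
proof
  assume ?L
  then obtain V where V: "0 \<in> interior V" "\<U> \<preceq> {(\<lambda>v. v + x) ` V | x. x \<in> UNIV}"
    unfolding right_uniform_covering_def by blast
  have "\<exists>U\<in>\<U>. \<forall>w\<in>interior V. w + x \<in> U" for x
  proof -
    obtain U where "U \<in> \<U>" "(\<lambda>v. v + x) ` V \<subseteq> U"
      using V(2) unfolding refined_by_def by blast
    then show ?thesis
      using interior_subset by blast
  qed
  with V(1) show ?R
    by (intro exI[of _ "interior V"]) simp
next
  assume ?R
  then obtain W where W: "open W" "0 \<in> W" "\<And>x. \<exists>U\<in>\<U>. \<forall>w\<in>W. w + x \<in> U"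
    by blast
  have "\<U> \<preceq> {(\<lambda>v. v + x) ` W | x. x \<in> UNIV}"
    unfolding refined_by_def
  proof
    fix V assume "V \<in> {(\<lambda>v. v + x) ` W | x. x \<in> UNIV}"
    then obtain x where x: "V = (\<lambda>v. v + x) ` W" by blast
    obtain U where "U \<in> \<U>" "\<forall>w\<in>W. w + x \<in> U" using W(3) by blast
    then show "\<exists>U\<in>\<U>. V \<subseteq> U" unfolding x by (intro bexI[of _ U]) auto
  qed
  then show ?L
    unfolding right_uniform_covering_def using W(1,2)
    by (intro exI[of _ W] conjI) (simp_all add: interior_open)
qed

lemma refined_by_refl: "\<U> \<preceq> \<U>"
  by (auto simp: refined_by_def)

lemma refined_by_trans: "\<U> \<preceq> \<V> \<Longrightarrow> \<V> \<preceq> \<W> \<Longrightarrow> \<U> \<preceq> \<W>"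
  unfolding refined_by_def by (meson order_trans)

lemma right_uniform_covering_coarser:
  assumes "\<U> \<preceq> \<V>" "right_uniform_covering \<V>"
  shows "right_uniform_covering \<U>"
  using assms unfolding right_uniform_covering_def by (meson refined_by_trans)

lemma right_uniform_covering_covers:
  assumes "right_uniform_covering \<U>"
  shows "\<exists>U\<in>\<U>. x \<in> U"
  using assms unfolding right_uniform_covering_iff by (metis add_0)

lemma right_uniform_covering_left_translate:
  assumes "right_uniform_covering \<U>"
  shows "right_uniform_covering (left_translate g \<U>)"
proof -
  from assms obtain W where W: "open W" "0 \<in> W" "\<And>x. \<exists>U\<in>\<U>. \<forall>w\<in>W. w + x \<in> U"
    unfolding right_uniform_covering_iff by blast
  \<comment> \<open>The conjugate \<open>?W\<close> satisfies \<open>?W + x = g + (W + (- g + x))\<close>.\<close>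
  let ?W = "(\<lambda>w. - g + w + g) -` W"
  have "open ?W"
    by (intro open_vimage W(1) continuous_intros)
  moreover have "0 \<in> ?W"
    using W(2) by simp
  moreover have "\<exists>U\<in>left_translate g \<U>. \<forall>w\<in>?W. w + x \<in> U" for x
  proof -
    obtain U where U: "U \<in> \<U>" "\<And>w. w \<in> W \<Longrightarrow> w + (- g + x) \<in> U"
      using W(3) by blast
    have "w + x \<in> (\<lambda>x. g + x) ` U" if "w \<in> ?W" for w
    proof
      show "w + x = g + (- g + w + g + (- g + x))"
        by (simp add: add.assoc)
      show "- g + w + g + (- g + x) \<in> U"
        using U(2) that by blast
    qed
    then show ?thesis
      using U(1) unfolding left_translate_def by blast
  qed
  ultimately show ?thesis
    unfolding right_uniform_covering_iff by blast
qed

lemma coverings_join_iff: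
  "A \<in> coverings_join I \<U> \<longleftrightarrow> (\<exists>U. A = (\<Inter>i\<in>I. U i) \<and> (\<forall>i\<in>I. U i \<in> \<U> i))"
  by (auto simp: coverings_join_def)

lemma coverings_join_left_translate_iff:
  "A \<in> coverings_join E (\<lambda>g. left_translate g \<U>) \<longleftrightarrow>
     (\<exists>U. A = (\<Inter>g\<in>E. (\<lambda>x. g + x) ` U g) \<and> (\<forall>g\<in>E. U g \<in> \<U>))"
proof
  assume "A \<in> coverings_join E (\<lambda>g. left_translate g \<U>)"
  then obtain U' where U': "A = (\<Inter>g\<in>E. U' g)" "\<forall>g\<in>E. \<exists>U\<in>\<U>. U' g = (\<lambda>x. g + x) ` U"
    unfolding coverings_join_iff left_translate_def by (elim exE conjE) force
  from U'(2) obtain U where "\<forall>g\<in>E. U g \<in> \<U> \<and> U' g = (\<lambda>x. g + x) ` U g"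
    by metis
  with U'(1) show "\<exists>U. A = (\<Inter>g\<in>E. (\<lambda>x. g + x) ` U g) \<and> (\<forall>g\<in>E. U g \<in> \<U>)"
    by auto
qed (auto simp: coverings_join_iff left_translate_def)

lemma right_uniform_covering_coverings_join:
  assumes "finite I" "\<And>i. i \<in> I \<Longrightarrow> right_uniform_covering (\<U> i)"
  shows "right_uniform_covering (coverings_join I \<U>)"
proof -
  have "\<forall>i\<in>I. \<exists>W. open W \<and> 0 \<in> W \<and> (\<forall>x. \<exists>U\<in>\<U> i. \<forall>w\<in>W. w + x \<in> U)"
    using assms(2) unfolding right_uniform_covering_iff by blast
  then obtain W where W: "\<And>i. i \<in> I \<Longrightarrow> open (W i) \<and> 0 \<in> W i"
      "\<And>i x. i \<in> I \<Longrightarrow> \<exists>U\<in>\<U> i. \<forall>w\<in>W i. w + x \<in> U"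
    by metis
  have "open (\<Inter>i\<in>I. W i)" "0 \<in> (\<Inter>i\<in>I. W i)"
    using W(1) assms(1) by auto
  moreover have "\<exists>U\<in>coverings_join I \<U>. \<forall>w\<in>(\<Inter>i\<in>I. W i). w + x \<in> U" for x
  proof -
    obtain U where "\<And>i. i \<in> I \<Longrightarrow> U i \<in> \<U> i \<and> (\<forall>w\<in>W i. w + x \<in> U i)"
      using W(2)[where x = x] by metis
    then show ?thesis
      by (intro bexI[of _ "\<Inter>i\<in>I. U i"]) (auto simp: coverings_join_iff)
  qed
  ultimately show ?thesis
    unfolding right_uniform_covering_iff by blast
qed

lemma finite_coverings_join:
  assumes "finite I" "\<And>i. i \<in> I \<Longrightarrow> finite (\<U> i)"
  shows "finite (coverings_join I \<U>)"
proof -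
  have "coverings_join I \<U> \<subseteq> (\<lambda>U. \<Inter>i\<in>I. U i) ` PiE I \<U>"
  proof
    fix A assume "A \<in> coverings_join I \<U>"
    then obtain U where "A = (\<Inter>i\<in>I. U i)" "\<forall>i\<in>I. U i \<in> \<U> i"
      by (auto simp: coverings_join_iff)
    then show "A \<in> (\<lambda>U. \<Inter>i\<in>I. U i) ` PiE I \<U>"
      by (intro image_eqI[of _ _ "restrict U I"]) auto
  qed
  then show ?thesis
    using assms by (meson finite_PiE finite_imageI finite_subset)
qed

lemma coverings_join_left_translate_finite_uniform:
  assumes "finite E" "\<V> \<in> finite_right_uniform_coverings"
  shows "coverings_join E (\<lambda>g. left_translate g \<V>) \<in> finite_right_uniform_coverings"
proof -
  have "finite (left_translate g \<V>)" for g
    using assms(2) by (simp add: finite_right_uniform_coverings_def left_translate_def setcompr_eq_image)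
  with assms show ?thesis
    by (auto simp: finite_right_uniform_coverings_def finite_coverings_join
        right_uniform_covering_coverings_join right_uniform_covering_left_translate)
qed

lemma uniform_complexity_le:
  assumes "\<V> \<in> finite_right_uniform_coverings" "\<U> \<preceq> \<V>"
  shows "uniform_complexity \<U> \<le> card \<V>"
  unfolding uniform_complexity_def using assms by (intro wellorder_Inf_le1) blast

lemma uniform_complexity_attained:
  assumes "\<U> \<in> finite_right_uniform_coverings"
  obtains \<V> where "\<V> \<in> finite_right_uniform_coverings" "\<U> \<preceq> \<V>" "card \<V> = uniform_complexity \<U>"
proof -
  have "uniform_complexity \<U> \<in> {card \<V> | \<V>. \<V> \<in> finite_right_uniform_coverings \<and> \<U> \<preceq> \<V>}"
    unfolding uniform_complexity_def using assms refined_by_refl by (intro Inf_nat_def1) blast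
  then show ?thesis
    using that by force
qed

lemma uniform_complexity_pos:
  assumes "\<U> \<in> finite_right_uniform_coverings"
  shows "uniform_complexity \<U> > 0"
proof -
  obtain \<V> where \<V>: "\<V> \<in> finite_right_uniform_coverings" "\<U> \<preceq> \<V>"
      "card \<V> = uniform_complexity \<U>"
    by (rule uniform_complexity_attained[OF assms])
  then have "finite \<V>" "\<V> \<noteq> {}"
    using right_uniform_covering_covers by (auto simp: finite_right_uniform_coverings_def)
  with \<V>(3) show ?thesis
    by (metis card_gt_0_iff)
qed

text \<open>This allows a point to be chosen in every member of a covering.\<close>

lemma right_uniform_covering_remove_empty:
  assumes "right_uniform_covering \<U>"
  shows "right_uniform_covering (\<U> - {{}})"
proof -
  from assms obtain W where W: "open W" "0 \<in> W" "\<And>x. \<exists>U\<in>\<U>. \<forall>w\<in>W. w + x \<in> U"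
    unfolding right_uniform_covering_iff by blast
  then have "\<exists>U\<in>\<U> - {{}}. \<forall>w\<in>W. w + x \<in> U" for x
    by (metis Diff_iff emptyE singletonD)
  with W(1,2) show ?thesis
    unfolding right_uniform_covering_iff by blast
qed

section \<open>Uniformly continuous functions\<close>

text \<open>
  Read as a uniform limit, uniform continuity inherits the calculus of uniform limits.
\<close>

lemma right_uniformly_continuous_iff:
  "right_uniformly_continuous f \<longleftrightarrow> uniform_limit UNIV (\<lambda>w x. f (w + x)) f (nhds 0)"
  (is "?L \<longleftrightarrow> ?R")
proof
  assume L: ?L
  show ?R
    unfolding uniform_limit_iff
  proof (intro allI impI)
    fix e :: real assume "e > 0"
    then have "real_uniform_covering {ball x (e/2) | x. x \<in> UNIV}"
      unfolding real_uniform_covering_def using refined_by_refl half_gt_zero by blast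
    with L have "right_uniform_covering {f -` U | U. U \<in> {ball x (e/2) | x. x \<in> UNIV}}"
      unfolding right_uniformly_continuous_def by blast
    then obtain W where W: "open W" "0 \<in> W"
        "\<And>x. \<exists>U\<in>{f -` U | U. U \<in> {ball x (e/2) | x. x \<in> UNIV}}. \<forall>w\<in>W. w + x \<in> U"
      unfolding right_uniform_covering_iff by blast
    have "dist (f (w + x)) (f x) < e" if w: "w \<in> W" for w x
    proof -
      obtain y where y: "\<And>w. w \<in> W \<Longrightarrow> f (w + x) \<in> ball y (e/2)"
        using W(3)[of x] by blast
      show ?thesis
        using y[OF w] y[OF W(2)] by (auto intro: dist_triangle_half_r)
    qed
    then show "\<forall>\<^sub>F w in nhds 0. \<forall>x\<in>UNIV. dist (f (w + x)) (f x) < e"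
      unfolding eventually_nhds using W(1,2) by blast
  qed
next
  assume R: ?R
  show ?L
    unfolding right_uniformly_continuous_def
  proof (intro allI impI)
    fix \<U> assume "real_uniform_covering \<U>"
    then obtain r where r: "r > 0" "\<And>x. \<exists>U\<in>\<U>. ball x r \<subseteq> U"
      unfolding real_uniform_covering_def refined_by_def by blast
    obtain W where W: "open W" "0 \<in> W" "\<And>w x. w \<in> W \<Longrightarrow> dist (f (w + x)) (f x) < r"
      using R r(1) unfolding uniform_limit_iff eventually_nhds by (metis UNIV_I)
    have "\<exists>A\<in>{f -` U | U. U \<in> \<U>}. \<forall>w\<in>W. w + x \<in> A" for x
    proof -
      obtain U where "U \<in> \<U>" "ball (f x) r \<subseteq> U"
        using r(2) by blast
      then show ?thesis
        using W(3) by (intro bexI[of _ "f -` U"]) (auto simp: dist_commute subset_iff)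
    qed
    with W(1,2) show "right_uniform_covering {f -` U | U. U \<in> \<U>}"
      unfolding right_uniform_covering_iff by blast
  qed
qed

lemma UC_b_iff:
  "f \<in> UC_b \<longleftrightarrow> bounded (range f) \<and> uniform_limit UNIV (\<lambda>w x. f (w + x)) f (nhds 0)"
  by (simp add: UC_b_def right_uniformly_continuous_iff)

lemma UC_b_const: "(\<lambda>x. c) \<in> UC_b"
  by (simp add: UC_b_iff image_constant_conv uniform_limit_const)

lemma UC_b_add: "f \<in> UC_b \<Longrightarrow> h \<in> UC_b \<Longrightarrow> (\<lambda>x. f x + h x) \<in> UC_b"
  by (auto simp: UC_b_iff intro: bounded_plus_comp uniform_limit_add)

lemma UC_b_mult: "f \<in> UC_b \<Longrightarrow> h \<in> UC_b \<Longrightarrow> (\<lambda>x. f x * h x) \<in> UC_b"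
proof -
  assume fh: "f \<in> UC_b" "h \<in> UC_b"
  then obtain a b where "\<And>x. norm (f x) \<le> a" "\<And>x. norm (h x) \<le> b"
    unfolding UC_b_iff bounded_iff by auto
  then have "norm (f x * h x) \<le> a * b" for x
    by (simp add: abs_mult mult_mono')
  then have "bounded (range (\<lambda>x. f x * h x))"
    unfolding bounded_iff by blast
  with fh show ?thesis
    by (auto simp: UC_b_iff intro!: uniform_lim_mult)
qed

lemma UC_b_sum: "(\<And>i. i \<in> I \<Longrightarrow> f i \<in> UC_b) \<Longrightarrow> (\<lambda>x. \<Sum>i\<in>I. f i x) \<in> UC_b"
  by (induction I rule: infinite_finite_induct) (auto intro: UC_b_const UC_b_add)

lemma UC_b_prod: "(\<And>i. i \<in> I \<Longrightarrow> f i \<in> UC_b) \<Longrightarrow> (\<lambda>x. \<Prod>i\<in>I. f i x) \<in> UC_b"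
  by (induction I rule: infinite_finite_induct) (auto intro: UC_b_const UC_b_mult)

lemma UC_b_divide:
  assumes "f \<in> UC_b" "h \<in> UC_b" "c > 0" "\<And>x. c \<le> h x"
  shows "(\<lambda>x. f x / h x) \<in> UC_b"
proof -
  obtain a where a: "\<And>x. \<bar>f x\<bar> \<le> a"
    using assms(1) unfolding UC_b_iff bounded_iff by auto
  have "\<bar>f x / h x\<bar> \<le> a / c" for x
  proof -
    have "0 < h x" "0 \<le> a"
      using assms(3,4) a by (meson less_le_trans abs_ge_zero order_trans)+
    then have "\<bar>f x / h x\<bar> = \<bar>f x\<bar> / h x" by simp
    also have "\<dots> \<le> a / c"
      using a assms(3,4) \<open>0 \<le> a\<close> by (intro frac_le) auto
    finally show ?thesis .
  qed
  then have "bounded (range (\<lambda>x. f x / h x))"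
    unfolding bounded_iff real_norm_def by blast
  moreover have "c \<le> \<bar>h x\<bar>" for x
    using assms(4)[of x] by linarith
  ultimately show ?thesis
    using assms by (auto simp: UC_b_iff intro!: uniform_lim_divide[where b = c])
qed

lemma UC_b_left_translate:
  fixes f :: "'a::topological_group_add \<Rightarrow> real"
  assumes "f \<in> UC_b"
  shows "(\<lambda>x. f (g + x)) \<in> UC_b"
proof -
  have "bounded (range (\<lambda>x. f (g + x)))"
    using assms unfolding UC_b_iff by (auto intro: bounded_subset)
  moreover have "uniform_limit UNIV (\<lambda>w x. f (g + (w + x))) (\<lambda>x. f (g + x)) (nhds 0)"
    unfolding uniform_limit_iff
  proof (intro allI impI)
    fix e :: real assume "e > 0"
    then have "\<forall>\<^sub>F w in nhds 0. \<forall>x. dist (f (w + x)) (f x) < e"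
      using assms by (simp add: UC_b_iff uniform_limit_iff)
    moreover have "filterlim (\<lambda>w. g + w - g) (nhds (g + 0 - g)) (nhds (0::'a))"
      unfolding diff_conv_add_uminus by (intro tendsto_intros filterlim_ident)
    ultimately have "\<forall>\<^sub>F w in nhds 0. \<forall>x. dist (f (g + w - g + x)) (f x) < e"
      using eventually_compose_filterlim by fastforce
    then show "\<forall>\<^sub>F w in nhds 0. \<forall>x\<in>UNIV. dist (f (g + (w + x))) (f (g + x)) < e"
    proof eventually_elim
      case (elim w)
      have "g + w - g + (g + x) = g + (w + x)" for x
        by (simp add: add.assoc diff_conv_add_uminus del: add_uminus_conv_diff)
      with elim show ?case by metis
    qed
  qed
  ultimately show ?thesis
    by (simp add: UC_b_iff)
qed

lemma UC_b_continuous: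
  fixes f :: "'a::topological_group_add \<Rightarrow> real"
  assumes "f \<in> UC_b"
  shows "continuous_on UNIV f"
  unfolding continuous_on_def
proof
  fix x :: 'a
  have "(f \<longlongrightarrow> f x) (nhds x)"
  proof (rule tendstoI)
    fix e :: real assume "e > 0"
    then have "\<forall>\<^sub>F w in nhds 0. \<forall>x. dist (f (w + x)) (f x) < e"
      using assms by (simp add: UC_b_iff uniform_limit_iff)
    moreover have "filterlim (\<lambda>y. y - x) (nhds (x - x)) (nhds x)"
      unfolding diff_conv_add_uminus by (intro tendsto_intros filterlim_ident)
    ultimately have "\<forall>\<^sub>F y in nhds x. \<forall>z. dist (f (y - x + z)) (f z) < e"
      using eventually_compose_filterlim by fastforce
    then show "\<forall>\<^sub>F y in nhds x. dist (f y) (f x) < e"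
      by (rule eventually_mono) (metis diff_add_cancel)
  qed
  then show "(f \<longlongrightarrow> f x) (at x within UNIV)"
    using tendsto_mono[OF at_within_le_nhds] by blast
qed

text \<open>
  Sampling the functions on a grid of mesh \<open>d\<close> gives a finite uniform covering on whose members
  all of them vary by little.
\<close>

lemma UC_b_small_oscillation:
  fixes F :: "('a::topological_group_add \<Rightarrow> real) set"
  assumes "finite F" "F \<subseteq> UC_b" "e > 0"
  obtains \<U> where "\<U> \<in> finite_right_uniform_coverings"
    "\<And>U f x y. U \<in> \<U> \<Longrightarrow> f \<in> F \<Longrightarrow> x \<in> U \<Longrightarrow> y \<in> U \<Longrightarrow> \<bar>f x - f y\<bar> \<le> e"
proof -
  define d where "d = e / 4"
  have d: "d > 0" using assms(3) by (simp add: d_def)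
  define c where "c x = restrict (\<lambda>f. \<lfloor>f x / d\<rfloor>) F" for x
  define A where "A \<kappa> = {y. \<forall>f\<in>F. \<bar>f y - d * of_int (\<kappa> f)\<bar> < 2 * d}" for \<kappa>
  have "finite (range c)"
  proof -
    have "\<forall>f\<in>F. \<exists>b. \<forall>x. \<bar>f x\<bar> \<le> b"
      using assms(2) by (auto simp: UC_b_iff bounded_iff subset_iff)
    then obtain b where b: "\<And>f x. f \<in> F \<Longrightarrow> \<bar>f x\<bar> \<le> b f"
      by metis
    then have "- b f / d \<le> f x / d \<and> f x / d \<le> b f / d" if "f \<in> F" for f x
      using that d by (intro conjI divide_right_mono) (metis abs_le_D1 abs_le_D2 minus_le_iff less_imp_le)+
    then have "range c \<subseteq> PiE F (\<lambda>f. {\<lfloor>- b f / d\<rfloor>..\<lfloor>b f / d\<rfloor>})"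
      unfolding c_def by (auto intro!: floor_mono)
    then show ?thesis
      using assms(1) by (meson finite_PiE finite_atLeastAtMost_int finite_subset)
  qed
  moreover have "right_uniform_covering (A ` range c)"
  proof -
    have "\<forall>\<^sub>F w in nhds 0. \<forall>f\<in>F. \<forall>x. dist (f (w + x)) (f x) < d"
      using assms(1,2) d by (auto simp: eventually_ball_finite_distrib UC_b_iff uniform_limit_iff subset_iff)
    then obtain W where W: "open W" "0 \<in> W" "\<And>w f x. w \<in> W \<Longrightarrow> f \<in> F \<Longrightarrow> \<bar>f (w + x) - f x\<bar> < d"
      unfolding eventually_nhds dist_real_def by blast
    have "w + x \<in> A (c x)" if "w \<in> W" for w x
      unfolding A_def
    proof (intro CollectI ballI)
      fix f assume f: "f \<in> F"
      have "d * of_int \<lfloor>f x / d\<rfloor> \<le> d * (f x / d)" "d * (f x / d) < d * (of_int \<lfloor>f x / d\<rfloor> + 1)"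
        using d by (intro mult_left_mono mult_strict_left_mono; linarith)+
      then have "d * of_int \<lfloor>f x / d\<rfloor> \<le> f x" "f x < d * of_int \<lfloor>f x / d\<rfloor> + d"
        using d by (simp_all add: distrib_left)
      with W(3)[OF that f, of x] f show "\<bar>f (w + x) - d * of_int (c x f)\<bar> < 2 * d"
        by (simp add: c_def)
    qed
    with W(1,2) show ?thesis
      unfolding right_uniform_covering_iff by blast
  qed
  ultimately have "A ` range c \<in> finite_right_uniform_coverings"
    by (simp add: finite_right_uniform_coverings_def)
  moreover have "\<bar>f x - f y\<bar> \<le> e" if "U \<in> A ` range c" "f \<in> F" "x \<in> U" "y \<in> U" for U f x y
  proof -
    from that obtain \<kappa> where "\<bar>f x - d * of_int (\<kappa> f)\<bar> < 2 * d" "\<bar>f y - d * of_int (\<kappa> f)\<bar> < 2 * d"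
      unfolding A_def by blast
    then show ?thesis
      unfolding d_def by linarith
  qed
  ultimately show ?thesis
    using that by blast
qed

section \<open>Uniformly continuous partitions of unity\<close>

lemma neighbourhood_of_zero_pair:
  fixes h :: "'a::topological_group_add \<times> 'a \<Rightarrow> 'b::topological_space"
  assumes "continuous_on UNIV h" "open Q" "h (0, 0) \<in> Q"
  shows "\<exists>V. open V \<and> 0 \<in> V \<and> (\<forall>a\<in>V. \<forall>b\<in>V. h (a, b) \<in> Q)"
proof -
  have "open (h -` Q)"
    using assms(1,2) by (rule open_vimage[rotated])
  moreover have "(0, 0) \<in> h -` Q"
    using assms(3) by simp
  ultimately obtain A B where AB: "open A" "open B" "(0, 0) \<in> A \<times> B" "A \<times> B \<subseteq> h -` Q"
    by (rule open_prod_elim)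
  then show ?thesis
    by (intro exI[of _ "A \<inter> B"]) auto
qed

lemma neighbourhood_of_zero_triple_sum:
  fixes W :: "'a::topological_group_add set"
  assumes "open W" "0 \<in> W"
  shows "\<exists>V. open V \<and> 0 \<in> V \<and> (\<forall>a\<in>V. \<forall>b\<in>V. \<forall>c\<in>V. a + b + c \<in> W)"
proof -
  have half: "\<exists>V. open V \<and> 0 \<in> V \<and> (\<forall>a\<in>V. \<forall>b\<in>V. a + b \<in> Q)" if "open Q" "0 \<in> Q" for Q :: "'a set"
  proof -
    have "continuous_on UNIV (\<lambda>p :: 'a \<times> 'a. fst p + snd p)"
      by (intro continuous_intros)
    from neighbourhood_of_zero_pair[OF this \<open>open Q\<close>] that(2) show ?thesis by simp
  qed
  obtain V1 where V1: "open V1" "0 \<in> V1" "\<forall>a\<in>V1. \<forall>b\<in>V1. a + b \<in> W"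
    using half[OF assms] by blast
  obtain V2 where V2: "open V2" "0 \<in> V2" "\<forall>a\<in>V2. \<forall>b\<in>V2. a + b \<in> V1"
    using half[OF V1(1,2)] by blast
  have "c \<in> V1" if "c \<in> V2" for c
    using V2(2,3) that by (metis add_0)
  then show ?thesis
    using V1(3) V2 by (intro exI[of _ V2]) auto
qed

lemma sum_list_split_at:
  fixes c :: "'b \<Rightarrow> real"
  assumes "0 \<le> s" "s < sum_list (map c xs)"
  shows "\<exists>ys z zs. xs = ys @ z # zs \<and> sum_list (map c ys) \<le> s \<and> s < sum_list (map c ys) + c z"
  using assms
proof (induction xs arbitrary: s)
  case (Cons x xs)
  show ?case
  proof (cases "s < c x")
    case True
    with Cons.prems show ?thesis
      by (intro exI[of _ "[]"] exI[of _ x] exI[of _ xs]) simp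
  next
    case False
    with Cons.prems Cons.IH[of "s - c x"] obtain ys z zs where
      "xs = ys @ z # zs" "sum_list (map c ys) \<le> s - c x" "s - c x < sum_list (map c ys) + c z"
      by auto
    then show ?thesis
      by (intro exI[of _ "x # ys"] exI[of _ z] exI[of _ zs]) auto
  qed
qed simp

text \<open>
  The chain lemma of Birkhoff and Kakutani. Cutting a chain at half of its cost leaves two shorter
  chains of at most half the cost and a single link in between.
\<close>

lemma chain_sum_mem:
  fixes V :: "nat \<Rightarrow> 'a::group_add set"
  assumes zero: "\<And>n. 0 \<in> V n"
    and cube: "\<And>n a b c. a \<in> V (Suc n) \<Longrightarrow> b \<in> V (Suc n) \<Longrightarrow> c \<in> V (Suc n) \<Longrightarrow> a + b + c \<in> V n"
    and links: "\<forall>l\<in>set ls. snd l \<in> V (fst l)"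
    and cost: "(\<Sum>l\<leftarrow>ls. (1/2) ^ fst l :: real) < (1/2) ^ m"
  shows "sum_list (map snd ls) \<in> V m"
  using links cost
proof (induction ls arbitrary: m rule: length_induct)
  case (1 ls)
  let ?c = "\<lambda>ls :: (nat \<times> 'a) list. (\<Sum>l\<leftarrow>ls. (1/2) ^ fst l :: real)"
  have c_nonneg: "?c ls \<ge> 0" for ls
    by (intro sum_list_nonneg) auto
  have decreasing: "V n \<subseteq> V k" if "k \<le> n" for k n
  proof (rule lift_Suc_antimono_le[OF _ that])
    show "V (Suc n) \<subseteq> V n" for n
      using cube[of _ n 0 0] zero by auto
  qed
  show ?case
  proof (cases "ls = []")
    case True
    then show ?thesis using zero by simp
  next
    case False
    then obtain l ls' where "ls = l # ls'" by (cases ls) auto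
    then have "?c ls > 0"
      using c_nonneg[of ls'] by (simp add: add_pos_nonneg)
    then obtain ys z zs where
      ls: "ls = ys @ z # zs" and ys: "?c ys \<le> ?c ls / 2" and z: "?c ls / 2 < ?c ys + (1/2) ^ fst z"
      using sum_list_split_at[of "?c ls / 2" "\<lambda>l. (1/2) ^ fst l" ls] by auto
    have cost_ls: "?c ls = ?c ys + (1/2) ^ fst z + ?c zs"
      by (simp add: ls)
    have half: "?c ls / 2 < (1/2) ^ Suc m"
      using 1(3) by simp
    have "sum_list (map snd ys) \<in> V (Suc m)"
      using 1(1)[rule_format, of ys "Suc m"] 1(2) ys half unfolding ls by auto
    moreover have "sum_list (map snd zs) \<in> V (Suc m)"
      using 1(1)[rule_format, of zs "Suc m"] 1(2) z half cost_ls unfolding ls by auto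
    moreover have "snd z \<in> V (Suc m)"
    proof -
      have "(1/2::real) ^ fst z < (1/2) ^ m"
        using 1(3) cost_ls c_nonneg[of ys] c_nonneg[of zs] by linarith
      then have "\<not> fst z \<le> m"
        using power_decreasing[of "fst z" m "1/2::real"] by auto
      then have "Suc m \<le> fst z" by simp
      then show ?thesis
        using decreasing 1(2) ls by auto
    qed
    ultimately show ?thesis
      using cube by (simp add: ls add.assoc)
  qed
qed

text \<open>
  This makes \<open>\<rho> (y - x)\<close> a right-invariant continuous quasi-pseudometric. The gauge \<open>\<rho>\<close> is the
  infimal cost of writing an element as a sum of links, where a link in \<open>V n\<close> costs \<open>(1/2) ^ n\<close> and
  the neighbourhoods \<open>V n\<close> shrink as the chain lemma demands.
\<close>

lemma exists_gauge:
  fixes W :: "'a::topological_group_add set"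
  assumes "open W" "0 \<in> W"
  obtains \<rho> :: "'a \<Rightarrow> real" where "\<rho> 0 = 0" "\<And>x. 0 \<le> \<rho> x" "\<And>x y. \<rho> (x + y) \<le> \<rho> x + \<rho> y"
    "\<And>x. x \<notin> W \<Longrightarrow> 1/2 \<le> \<rho> x" "(\<rho> \<longlongrightarrow> 0) (nhds 0)"
proof -
  \<comment> \<open>\<open>V 0 = UNIV\<close> makes every element a link; by \<open>V 1 \<subseteq> W\<close> the elements outside \<open>W\<close> cost at least \<open>1/2\<close>.\<close>
  have "\<exists>V. \<forall>n. (open (V n) \<and> 0 \<in> V n \<and> (n = 0 \<longrightarrow> V n = UNIV) \<and> (n > 0 \<longrightarrow> V n \<subseteq> W)) \<and>
      (\<forall>a b c. a \<in> V (Suc n) \<longrightarrow> b \<in> V (Suc n) \<longrightarrow> c \<in> V (Suc n) \<longrightarrow> a + b + c \<in> V n)"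
    (is "\<exists>V. \<forall>n. ?P n (V n) \<and> ?Q n (V n) (V (Suc n))")
  proof (rule dependent_nat_choice)
    show "\<exists>V. ?P 0 V" by auto
  next
    fix A :: "'a set" and n assume "?P n A"
    then obtain B where "open B" "0 \<in> B" "\<forall>a\<in>B. \<forall>b\<in>B. \<forall>c\<in>B. a + b + c \<in> A"
      using neighbourhood_of_zero_triple_sum[of A] by blast
    then show "\<exists>B. ?P (Suc n) B \<and> ?Q n A B"
      using assms by (intro exI[of _ "B \<inter> W"]) auto
  qed
  then obtain V where "\<forall>n. ?P n (V n) \<and> ?Q n (V n) (V (Suc n))" ..
  then have V: "\<And>n. open (V n)" "\<And>n. 0 \<in> V n" "V 0 = UNIV" "V 1 \<subseteq> W"
    "\<And>n a b c. a \<in> V (Suc n) \<Longrightarrow> b \<in> V (Suc n) \<Longrightarrow> c \<in> V (Suc n) \<Longrightarrow> a + b + c \<in> V n"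
    by auto
  define C where "C x = {(\<Sum>l\<leftarrow>ls. (1/2) ^ fst l :: real) | ls.
      (\<forall>l\<in>set ls. snd l \<in> V (fst l)) \<and> sum_list (map snd ls) = x}" for x
  define \<rho> where "\<rho> x = Inf (C x)" for x
  have C_nonneg: "0 \<le> r" if "r \<in> C x" for r x
    using that unfolding C_def by (auto intro!: sum_list_nonneg)
  have bdd: "bdd_below (C x)" for x
    using C_nonneg by (meson bdd_below.I)
  have single: "(1/2) ^ n \<in> C x" if "x \<in> V n" for n x
    unfolding C_def using that by (intro CollectI exI[of _ "[(n, x)]"]) simp
  have C_ne: "C x \<noteq> {}" for x
    using single[of x 0] V(3) by auto
  have \<rho>_le: "\<rho> x \<le> r" if "r \<in> C x" for r x
    unfolding \<rho>_def using bdd that by (rule cInf_lower[rotated])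
  have \<rho>_nonneg: "0 \<le> \<rho> x" for x
    unfolding \<rho>_def using C_ne C_nonneg by (rule cInf_greatest)
  have "0 \<in> C 0"
    unfolding C_def by (intro CollectI exI[of _ "[]"]) simp
  then have "\<rho> 0 = 0"
    using \<rho>_le \<rho>_nonneg by (meson order_antisym)
  moreover have "\<rho> (x + y) \<le> \<rho> x + \<rho> y" for x y
  proof (rule field_le_epsilon)
    fix e :: real assume "e > 0"
    then obtain r s where rs: "r \<in> C x" "r < \<rho> x + e/2" "s \<in> C y" "s < \<rho> y + e/2"
      using cInf_lessD[OF C_ne[of x], of "\<rho> x + e/2"] cInf_lessD[OF C_ne[of y], of "\<rho> y + e/2"]
      unfolding \<rho>_def by fastforce
    from rs(1,3) obtain ls ls' where
      "r = (\<Sum>l\<leftarrow>ls. (1/2) ^ fst l)" "\<forall>l\<in>set ls. snd l \<in> V (fst l)" "sum_list (map snd ls) = x"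
      "s = (\<Sum>l\<leftarrow>ls'. (1/2) ^ fst l)" "\<forall>l\<in>set ls'. snd l \<in> V (fst l)" "sum_list (map snd ls') = y"
      unfolding C_def by blast
    then have "r + s \<in> C (x + y)"
      unfolding C_def by (intro CollectI exI[of _ "ls @ ls'"]) auto
    with rs(2,4) \<rho>_le show "\<rho> (x + y) \<le> \<rho> x + \<rho> y + e"
      by fastforce
  qed
  moreover have "1/2 \<le> \<rho> x" if "x \<notin> W" for x
  proof (rule ccontr)
    assume "\<not> 1/2 \<le> \<rho> x"
    then obtain r where "r \<in> C x" "r < 1/2"
      using cInf_lessD[OF C_ne[of x], of "1/2"] unfolding \<rho>_def by (auto simp: not_le)
    then obtain ls where "\<forall>l\<in>set ls. snd l \<in> V (fst l)" "(\<Sum>l\<leftarrow>ls. (1/2) ^ fst l) < (1/2 :: real) ^ 1"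
      "sum_list (map snd ls) = x"
      unfolding C_def by auto
    then have "x \<in> V 1"
      using chain_sum_mem[of V ls 1] V(2,5) by blast
    with V(4) that show False by blast
  qed
  moreover have "(\<rho> \<longlongrightarrow> 0) (nhds 0)"
  proof (rule tendstoI)
    fix e :: real assume "e > 0"
    then obtain n where n: "(1/2) ^ n < e"
      using real_arch_pow_inv[of e "1/2"] by auto
    have "dist (\<rho> w) 0 < e" if "w \<in> V n" for w
      using \<rho>_le[OF single[OF that]] \<rho>_nonneg[of w] n by simp
    then show "\<forall>\<^sub>F w in nhds 0. dist (\<rho> w) 0 < e"
      using V(1,2) unfolding eventually_nhds by blast
  qed
  ultimately show ?thesis
    using that \<rho>_nonneg by blast
qed

text \<open>
  The distances to the complements of the members are uniformly continuous, and as the covering is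
  uniform, the largest of them is bounded away from \<open>0\<close>; so they can be normalised.
\<close>

lemma UC_b_partition_of_unity:
  fixes \<U> :: "'a::topological_group_add set set"
  assumes "\<U> \<in> finite_right_uniform_coverings"
  obtains f :: "'a set \<Rightarrow> 'a \<Rightarrow> real" where "\<And>U. f U \<in> UC_b" "\<And>U x. 0 \<le> f U x"
    "\<And>x. (\<Sum>U\<in>\<U>. f U x) = 1" "\<And>U x. f U x \<noteq> 0 \<Longrightarrow> x \<in> U"
proof -
  have fin: "finite \<U>"
    using assms by (simp add: finite_right_uniform_coverings_def)
  from assms obtain W where W: "open W" "0 \<in> W" "\<And>x. \<exists>U\<in>\<U>. \<forall>w\<in>W. w + x \<in> U"
    unfolding finite_right_uniform_coverings_def right_uniform_covering_iff by blast
  obtain \<rho> :: "'a \<Rightarrow> real" where \<rho>: "\<rho> 0 = 0" "\<And>x. 0 \<le> \<rho> x" "\<And>x y. \<rho> (x + y) \<le> \<rho> x + \<rho> y"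
    "\<And>x. x \<notin> W \<Longrightarrow> 1/2 \<le> \<rho> x" "(\<rho> \<longlongrightarrow> 0) (nhds 0)"
    using exists_gauge[OF W(1,2)] by blast
  \<comment> \<open>The distance to the complement of \<open>U\<close>, cut off at \<open>1\<close>.\<close>
  define t where "t U x = Inf (insert 1 ((\<lambda>y. \<rho> (y - x)) ` (- U)))" for U x
  have bdd: "bdd_below (insert 1 ((\<lambda>y. \<rho> (y - x)) ` (- U)))" for U x
    using \<rho>(2) by (intro bdd_belowI[of _ 0]) auto
  have t_nonneg: "0 \<le> t U x" for U x
    unfolding t_def by (rule cInf_greatest) (use \<rho>(2) in auto)
  have t_le_1: "t U x \<le> 1" for U x
    unfolding t_def by (rule cInf_lower) (use bdd in auto)
  have t_le: "t U x \<le> \<rho> (y - x)" if "y \<notin> U" for U x y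
    unfolding t_def by (rule cInf_lower) (use bdd that in auto)
  have t_Lipschitz: "t U x' \<le> t U x + \<rho> (x - x')" for U x x'
  proof -
    have "t U x' - \<rho> (x - x') \<le> t U x"
      unfolding t_def[of U x]
    proof (rule cInf_greatest)
      fix r assume "r \<in> insert 1 ((\<lambda>y. \<rho> (y - x)) ` (- U))"
      then consider "r = 1" | y where "y \<notin> U" "r = \<rho> (y - x)" by blast
      then show "t U x' - \<rho> (x - x') \<le> r"
      proof cases
        case 1
        then show ?thesis using t_le_1[of U x'] \<rho>(2)[of "x - x'"] by linarith
      next
        case 2
        have "y - x' = (y - x) + (x - x')" by (simp add: algebra_simps)
        then have "\<rho> (y - x') \<le> \<rho> (y - x) + \<rho> (x - x')" by (metis \<rho>(3))
        with t_le[OF 2(1), of x'] 2(2) show ?thesis by linarith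
      qed
    qed simp
    then show ?thesis by linarith
  qed
  have t_supp: "x \<in> U" if "t U x \<noteq> 0" for U x
    using t_le[of x U x] t_nonneg[of U x] \<rho>(1) that by force
  have t_half: "\<exists>U\<in>\<U>. 1/2 \<le> t U x" for x
  proof -
    obtain U where U: "U \<in> \<U>" "\<And>w. w \<in> W \<Longrightarrow> w + x \<in> U"
      using W(3) by blast
    have "y - x \<notin> W" if "y \<notin> U" for y
      using U(2)[of "y - x"] that by auto
    then have "1/2 \<le> t U x"
      unfolding t_def by (intro cInf_greatest) (use \<rho>(4) in auto)
    with U(1) show ?thesis by blast
  qed
  have t_UC: "t U \<in> UC_b" for U
    unfolding UC_b_iff
  proof
    show "bounded (range (t U))"
      using t_nonneg t_le_1 by (intro boundedI[of _ 1]) (auto simp: abs_le_iff, smt (verit))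
    show "uniform_limit UNIV (\<lambda>w x. t U (w + x)) (t U) (nhds 0)"
      unfolding uniform_limit_iff
    proof (intro allI impI)
      fix e :: real assume "e > 0"
      have "filterlim uminus (nhds (- 0)) (nhds (0::'a))"
        by (intro tendsto_intros filterlim_ident)
      then have "((\<lambda>w. \<rho> w + \<rho> (- w)) \<longlongrightarrow> 0 + 0) (nhds 0)"
        by (intro tendsto_add \<rho>(5) filterlim_compose[OF \<rho>(5)]) simp
      then have "\<forall>\<^sub>F w in nhds 0. \<rho> w + \<rho> (- w) < e"
        using \<open>e > 0\<close> by (intro order_tendstoD(2)) auto
      then show "\<forall>\<^sub>F w in nhds 0. \<forall>x\<in>UNIV. dist (t U (w + x)) (t U x) < e"
      proof eventually_elim
        case (elim w)
        show ?case
        proof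
          fix x
          have "x - (w + x) = - w"
            by (simp add: diff_conv_add_uminus minus_add add.assoc[symmetric] del: add_uminus_conv_diff)
          moreover have "w + x - x = w"
            by simp
          ultimately show "dist (t U (w + x)) (t U x) < e"
            using t_Lipschitz[of U "w + x" x] t_Lipschitz[of U x "w + x"] elim \<rho>(2)[of w] \<rho>(2)[of "- w"]
            by (auto simp: dist_real_def abs_less_iff)
        qed
      qed
    qed
  qed
  have sum_ge: "1/2 \<le> (\<Sum>U\<in>\<U>. t U x)" for x
  proof -
    obtain U where U: "U \<in> \<U>" "1/2 \<le> t U x" using t_half by blast
    then have "t U x \<le> (\<Sum>U\<in>\<U>. t U x)"
      using fin t_nonneg by (intro member_le_sum) auto
    with U(2) show ?thesis by linarith
  qed
  define f where "f U x = t U x / (\<Sum>U\<in>\<U>. t U x)" for U x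
  have "f U \<in> UC_b" for U
    unfolding f_def using t_UC sum_ge by (intro UC_b_divide[where c = "1/2"] UC_b_sum) auto
  moreover have "0 \<le> f U x" for U x
    unfolding f_def using t_nonneg sum_nonneg[of \<U> "\<lambda>U. t U x"] by simp
  moreover have "(\<Sum>U\<in>\<U>. f U x) = 1" for x
    using sum_ge[of x] by (simp add: f_def sum_divide_distrib[symmetric])
  moreover have "x \<in> U" if "f U x \<noteq> 0" for U x
    using that t_supp by (auto simp: f_def)
  ultimately show ?thesis
    using that by blast
qed

section \<open>Cutting finite sets out of uniform coverings\<close>

text \<open>
  Points of a finite set in a Hausdorff group are separated uniformly: a small translated
  neighbourhood contains at most one point \<open>p\<close> of \<open>P\<close>. If there is none, a member of \<open>\<U>\<close> without \<open>P\<close>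
  contains the neighbourhood, and otherwise a set belonging to a pair \<open>(T, U)\<close> with \<open>p \<in> T\<close>.
\<close>

lemma right_uniform_covering_cut_out:
  fixes P :: "'a::{topological_group_add, t2_space} set"
  assumes "right_uniform_covering \<U>" "finite P"
    and \<T>: "\<And>p. p \<in> P \<Longrightarrow> \<exists>T U. (T, U) \<in> \<T> \<and> p \<in> T \<and> p \<in> interior U"
  shows "right_uniform_covering ((\<lambda>U. U - P) ` \<U> \<union> (\<lambda>(T, U). U - (P - T)) ` \<T>)"
proof -
  from assms(1) obtain W where W: "open W" "0 \<in> W" "\<And>x. \<exists>U\<in>\<U>. \<forall>w\<in>W. w + x \<in> U"
    unfolding right_uniform_covering_iff by blast
  from \<T> obtain T U where TU: "\<And>p. p \<in> P \<Longrightarrow> (T p, U p) \<in> \<T> \<and> p \<in> T p \<and> p \<in> interior (U p)"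
    by metis
  have "\<exists>N. open N \<and> 0 \<in> N \<and> (\<forall>a\<in>N. \<forall>b\<in>N. a - b + p \<in> interior (U p) - (P - {p}))"
    if "p \<in> P" for p
  proof -
    have cont: "continuous_on UNIV (\<lambda>z :: 'a \<times> 'a. fst z + - snd z + p)"
      by (intro continuous_intros)
    have op: "open (interior (U p) - (P - {p}))"
      using assms(2) by (intro open_Diff finite_imp_closed) auto
    from neighbourhood_of_zero_pair[OF cont op] TU[OF that] show ?thesis
      by simp
  qed
  then obtain N where N: "\<And>p. p \<in> P \<Longrightarrow> open (N p)" "\<And>p. p \<in> P \<Longrightarrow> 0 \<in> N p"
    "\<And>p a b. p \<in> P \<Longrightarrow> a \<in> N p \<Longrightarrow> b \<in> N p \<Longrightarrow> a - b + p \<in> interior (U p) - (P - {p})"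
    by metis
  define W' where "W' = W \<inter> (\<Inter>p\<in>P. N p)"
  have "open W'" "0 \<in> W'"
    unfolding W'_def using W(1,2) N(1,2) assms(2) by (auto intro: open_INT)
  moreover have "\<exists>A\<in>(\<lambda>U. U - P) ` \<U> \<union> (\<lambda>(T, U). U - (P - T)) ` \<T>. \<forall>w\<in>W'. w + x \<in> A" for x
  proof (cases "\<exists>w\<in>W'. w + x \<in> P")
    case False
    obtain U where "U \<in> \<U>" "\<forall>w\<in>W. w + x \<in> U"
      using W(3) by blast
    then have "\<forall>w\<in>W'. w + x \<in> U - P"
      using False by (auto simp: W'_def)
    with \<open>U \<in> \<U>\<close> show ?thesis by blast
  next
    case True
    then obtain w0 where w0: "w0 \<in> W'" "w0 + x \<in> P" by blast
    define p where "p = w0 + x"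
    have "w + x \<in> U p - (P - T p)" if "w \<in> W'" for w
    proof -
      have "w + x = w - w0 + p"
        by (simp add: p_def diff_conv_add_uminus add.assoc del: add_uminus_conv_diff)
      moreover have "w - w0 + p \<in> interior (U p) - (P - {p})"
        using N(3) that w0 unfolding p_def W'_def by blast
      ultimately show ?thesis
        using TU[of p] w0(2) interior_subset[of "U p"] unfolding p_def by auto
    qed
    then have "\<forall>w\<in>W'. w + x \<in> (\<lambda>(T, U). U - (P - T)) (T p, U p)"
      by simp
    moreover have "(T p, U p) \<in> \<T>"
      using TU w0(2) by (simp add: p_def)
    ultimately show ?thesis
      by (meson UnI2 imageI)
  qed
  ultimately show ?thesis
    unfolding right_uniform_covering_iff by blast
qed

lemma open_infinite_of_nondiscrete:
  fixes A :: "'a::{topological_group_add, t2_space} set"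
  assumes "\<not> discrete (UNIV :: 'a set)" "open A" "A \<noteq> {}"
  shows "infinite A"
proof
  assume "finite A"
  obtain p where "p \<in> A" using assms(3) by blast
  have "open (A - (A - {p}))"
    using assms(2) \<open>finite A\<close> by (intro open_Diff finite_imp_closed) auto
  moreover have "A - (A - {p}) = {p}"
    using \<open>p \<in> A\<close> by blast
  ultimately have "open {p}" by simp
  have "x isolated_in UNIV" for x :: 'a
  proof -
    have "open ((\<lambda>y. y + - x + p) -` {p})"
      by (intro open_vimage \<open>open {p}\<close> continuous_intros)
    moreover have "(\<lambda>y. y + - x + p) -` {p} = {x}"
      by auto (metis add_0 add_right_cancel right_minus_eq)
    ultimately show ?thesis
      unfolding isolated_in_def by auto
  qed
  with assms(1) show False
    unfolding discrete_def by blast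
qed

text \<open>
  The members are small enough to contain at most one point of \<open>F\<close>, which makes \<open>|F|\<close> a lower bound
  for the complexity, and otherwise as large as those of \<open>\<U>\<close>, which allows points of different
  translates of \<open>F\<close> to share a member of the join.
\<close>

definition cut_out_covering :: "'a set \<Rightarrow> 'a set set \<Rightarrow> 'a set set" where
  "cut_out_covering F \<U> = {U - (F - T) | U T. U \<in> \<U> \<and> T \<subseteq> F \<and> card T \<le> 1}"

lemma refined_by_cut_out_covering: "\<U> \<preceq> cut_out_covering F \<U>"
  by (auto simp: refined_by_def cut_out_covering_def)

lemma cut_out_covering_finite_uniform:
  fixes F :: "'a::{topological_group_add, t2_space} set"
  assumes "\<U> \<in> finite_right_uniform_coverings" "finite F"
  shows "cut_out_covering F \<U> \<in> finite_right_uniform_coverings"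
proof -
  have fin: "finite \<U>" and unif: "right_uniform_covering \<U>"
    using assms(1) by (auto simp: finite_right_uniform_coverings_def)
  have "cut_out_covering F \<U> \<subseteq> (\<lambda>(U, T). U - (F - T)) ` (\<U> \<times> Pow F)"
    by (auto simp: cut_out_covering_def)
  then have "finite (cut_out_covering F \<U>)"
    using fin assms(2) by (meson finite_Pow_iff finite_SigmaI finite_imageI finite_subset)
  moreover have "right_uniform_covering (cut_out_covering F \<U>)"
  proof (rule right_uniform_covering_coarser)
    show "right_uniform_covering ((\<lambda>U. U - F) ` \<U> \<union>
        (\<lambda>(T, U). U - (F - T)) ` {({p}, U) | p U. p \<in> F \<and> U \<in> \<U>})"
    proof (rule right_uniform_covering_cut_out[OF unif assms(2)])
      fix p assume "p \<in> F"
      obtain W where W: "open W" "0 \<in> W" "\<And>x. \<exists>U\<in>\<U>. \<forall>w\<in>W. w + x \<in> U"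
        using unif unfolding right_uniform_covering_iff by blast
      obtain U where U: "U \<in> \<U>" "\<And>w. w \<in> W \<Longrightarrow> w + p \<in> U"
        using W(3) by blast
      have "open ((\<lambda>y. y + - p) -` W)"
        by (intro open_vimage W(1) continuous_intros)
      moreover have "(\<lambda>y. y + - p) -` W \<subseteq> U"
        using U(2) by (metis (no_types, lifting) add_uminus_conv_diff diff_add_cancel subsetI vimageE)
      ultimately have "p \<in> interior U"
        using W(2) by (auto intro!: interiorI[of "(\<lambda>y. y + - p) -` W"])
      with U(1) \<open>p \<in> F\<close>
      show "\<exists>T U. (T, U) \<in> {({p}, U) | p U. p \<in> F \<and> U \<in> \<U>} \<and> p \<in> T \<and> p \<in> interior U"
        by blast
    qed
    have "V \<in> cut_out_covering F \<U>"
      if "V \<in> (\<lambda>U. U - F) ` \<U> \<union> (\<lambda>(T, U). U - (F - T)) ` {({p}, U) | p U. p \<in> F \<and> U \<in> \<U>}" for V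
    proof -
      from that consider U where "U \<in> \<U>" "V = U - (F - {})"
        | U p where "U \<in> \<U>" "p \<in> F" "V = U - (F - {p})"
        by auto
      then show ?thesis
      proof cases
        case (1 U)
        then show ?thesis
          unfolding cut_out_covering_def by (intro CollectI exI[of _ U] exI[of _ "{}"]) simp
      next
        case (2 U p)
        then show ?thesis
          unfolding cut_out_covering_def by (intro CollectI exI[of _ U] exI[of _ "{p}"]) simp
      qed
    qed
    then show "cut_out_covering F \<U> \<preceq> (\<lambda>U. U - F) ` \<U> \<union>
        (\<lambda>(T, U). U - (F - T)) ` {({p}, U) | p U. p \<in> F \<and> U \<in> \<U>}"
      unfolding refined_by_def by (meson order_refl)
  qed
  ultimately show ?thesis
    by (simp add: finite_right_uniform_coverings_def)
qed

text \<open>A member of a refinement contains at most one point of \<open>F\<close>.\<close>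

lemma card_le_uniform_complexity_cut_out_covering:
  fixes F :: "'a::{topological_group_add, t2_space} set"
  assumes "\<U> \<in> finite_right_uniform_coverings" "finite F"
  shows "card F \<le> uniform_complexity (cut_out_covering F \<U>)"
proof -
  obtain \<W> where \<W>: "\<W> \<in> finite_right_uniform_coverings" "cut_out_covering F \<U> \<preceq> \<W>"
      "card \<W> = uniform_complexity (cut_out_covering F \<U>)"
    by (rule uniform_complexity_attained[OF cut_out_covering_finite_uniform[OF assms]])
  have "\<forall>x. \<exists>W\<in>\<W>. x \<in> W"
    using \<W>(1) right_uniform_covering_covers by (auto simp: finite_right_uniform_coverings_def)
  then obtain W where W: "\<And>x. W x \<in> \<W>" "\<And>x. x \<in> W x"
    by metis
  have "inj_on W F"
  proof (rule inj_onI)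
    fix x y assume xy: "x \<in> F" "y \<in> F" "W x = W y"
    obtain V where "V \<in> cut_out_covering F \<U>" "W x \<subseteq> V"
      using \<W>(2) W(1)[of x] unfolding refined_by_def by blast
    then obtain U T where UT: "W x \<subseteq> U - (F - T)" "T \<subseteq> F" "card T \<le> 1"
      by (auto simp: cut_out_covering_def)
    have "x \<in> T" "y \<in> T"
      using UT(1) xy W(2)[of x] W(2)[of y] by auto
    moreover have "finite T"
      using UT(2) assms(2) finite_subset by blast
    ultimately show "x = y"
      using UT(3) card_le_Suc0_iff_eq[of T] by auto
  qed
  moreover have "W ` F \<subseteq> \<W>" "finite \<W>"
    using W(1) \<W>(1) by (auto simp: finite_right_uniform_coverings_def)
  ultimately show ?thesis
    using \<W>(3) card_inj_on_le by metis
qed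

text \<open>
  A set of the join of the translates of \<open>cut_out_covering F \<U>\<close> may contain one point of each
  translate of \<open>F\<close>. Hence a family \<open>\<T>\<close> of transversals, each inside a member of the join of the
  translates of \<open>\<U>\<close>, bounds the complexity.
\<close>

lemma uniform_complexity_join_cut_out_covering_le:
  fixes F :: "'a::{topological_group_add, t2_space} set"
  assumes \<U>: "\<U> \<in> finite_right_uniform_coverings" and fin: "finite F" "finite E" "finite \<T>"
    and \<T>: "\<And>T U. (T, U) \<in> \<T> \<Longrightarrow> U \<in> coverings_join E (\<lambda>g. left_translate g \<U>)"
      "\<And>T U g. (T, U) \<in> \<T> \<Longrightarrow> g \<in> E \<Longrightarrow> \<exists>q. T \<inter> (\<lambda>x. g + x) ` F \<subseteq> {q}"
      "\<And>g x. g \<in> E \<Longrightarrow> x \<in> F \<Longrightarrow> \<exists>T U. (T, U) \<in> \<T> \<and> g + x \<in> T \<and> g + x \<in> interior U"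
  shows "uniform_complexity (coverings_join E (\<lambda>g. left_translate g (cut_out_covering F \<U>)))
    \<le> card (coverings_join E (\<lambda>g. left_translate g \<U>)) + card \<T>"
proof -
  let ?\<J> = "coverings_join E (\<lambda>g. left_translate g \<U>)"
  define P where "P = (\<Union>g\<in>E. (\<lambda>x. g + x) ` F)"
  let ?\<C> = "(\<lambda>U. U - P) ` ?\<J> \<union> (\<lambda>(T, U). U - (P - T)) ` \<T>"
  have \<J>: "finite ?\<J>" "right_uniform_covering ?\<J>"
    using coverings_join_left_translate_finite_uniform[OF fin(2) \<U>]
    by (auto simp: finite_right_uniform_coverings_def)
  have "right_uniform_covering ?\<C>"
    by (rule right_uniform_covering_cut_out[OF \<J>(2)]) (use fin \<T>(3) in \<open>auto simp: P_def\<close>)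
  with \<J>(1) fin(3) have "?\<C> \<in> finite_right_uniform_coverings"
    by (simp add: finite_right_uniform_coverings_def)
  moreover have "coverings_join E (\<lambda>g. left_translate g (cut_out_covering F \<U>)) \<preceq> ?\<C>"
  proof -
    have refines: "\<exists>A\<in>coverings_join E (\<lambda>g. left_translate g (cut_out_covering F \<U>)). U - (P - T) \<subseteq> A"
      if "U \<in> ?\<J>" and T: "\<And>g. g \<in> E \<Longrightarrow> \<exists>q. T \<inter> (\<lambda>x. g + x) ` F \<subseteq> {q}" for U T
    proof -
      from \<open>U \<in> ?\<J>\<close> obtain V where V: "U = (\<Inter>g\<in>E. (\<lambda>x. g + x) ` V g)" "\<forall>g\<in>E. V g \<in> \<U>"
        unfolding coverings_join_left_translate_iff by blast
      define T' where "T' g = {x \<in> F. g + x \<in> T}" for g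
      define V' where "V' g = V g - (F - T' g)" for g
      have "V' g \<in> cut_out_covering F \<U>" if "g \<in> E" for g
      proof -
        obtain q where q: "T \<inter> (\<lambda>x. g + x) ` F \<subseteq> {q}" using T[OF \<open>g \<in> E\<close>] by blast
        have "T' g \<subseteq> {- g + q}"
        proof
          fix x assume "x \<in> T' g"
          with q have "g + x = q" by (auto simp: T'_def)
          then show "x \<in> {- g + q}" by auto
        qed
        then have "card (T' g) \<le> 1"
          using card_mono[of "{- g + q}"] by fastforce
        then show ?thesis
          unfolding cut_out_covering_def V'_def using V(2) that by (auto simp: T'_def)
      qed
      then have "(\<Inter>g\<in>E. (\<lambda>x. g + x) ` V' g)
          \<in> coverings_join E (\<lambda>g. left_translate g (cut_out_covering F \<U>))"
        by (subst coverings_join_left_translate_iff) (intro exI[of _ V'] conjI ballI refl)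
      moreover have "U - (P - T) \<subseteq> (\<Inter>g\<in>E. (\<lambda>x. g + x) ` V' g)"
      proof
        fix q assume q: "q \<in> U - (P - T)"
        have "q \<in> (\<lambda>x. g + x) ` V' g" if "g \<in> E" for g
        proof -
          have "q \<in> (\<lambda>x. g + x) ` V g"
            using q that by (simp add: V(1))
          then obtain v where v: "v \<in> V g" "q = g + v"
            by blast
          have "v \<in> V' g"
            using v q that by (auto simp: V'_def T'_def P_def)
          with v(2) show ?thesis by blast
        qed
        then show "q \<in> (\<Inter>g\<in>E. (\<lambda>x. g + x) ` V' g)" by blast
      qed
      ultimately show ?thesis
        by (rule bexI[rotated])
    qed
    have "\<exists>A\<in>coverings_join E (\<lambda>g. left_translate g (cut_out_covering F \<U>)). U - P \<subseteq> A"
      if "U \<in> ?\<J>" for U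
      using refines[OF that, of "{}"] by simp
    moreover have "\<exists>A\<in>coverings_join E (\<lambda>g. left_translate g (cut_out_covering F \<U>)). U - (P - T) \<subseteq> A"
      if "(T, U) \<in> \<T>" for T U
      using refines[OF \<T>(1)[OF that], of T] \<T>(2)[OF that] by simp
    ultimately show ?thesis
      unfolding refined_by_def by auto
  qed
  ultimately have "uniform_complexity (coverings_join E (\<lambda>g. left_translate g (cut_out_covering F \<U>)))
      \<le> card ?\<C>"
    by (rule uniform_complexity_le)
  also have "\<dots> \<le> card ((\<lambda>U. U - P) ` ?\<J>) + card ((\<lambda>(T, U). U - (P - T)) ` \<T>)"
    by (rule card_Un_le)
  also have "\<dots> \<le> card ?\<J> + card \<T>"
    by (intro add_mono card_image_le \<J>(1) fin(3))
  finally show ?thesis .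
qed

section \<open>Coverings from invariant means\<close>

text \<open>
  The function \<open>\<psi> \<sigma> x = (\<Prod>g\<in>E. f (\<sigma> g) (g + x))\<close> is the term for the selection \<open>\<sigma>\<close> in the expansion
  of \<open>(\<Prod>g\<in>E. \<Sum>i\<in>I. f i (g + x)) = 1\<close>, and \<open>a \<sigma>\<close> is its mean. Adding up the terms with \<open>\<sigma> g = i\<close>
  leaves the translate of \<open>f i\<close> by \<open>g\<close>, whose mean \<open>b i\<close> does not depend on \<open>g\<close>.
\<close>

lemma amenable_marginals:
  fixes f :: "'i \<Rightarrow> 'a::topological_group_add \<Rightarrow> real" and E :: "'a set"
  assumes "amenable_group TYPE('a)" "finite I" "finite E"
    and f: "\<And>i. f i \<in> UC_b" "\<And>i x. 0 \<le> f i x" "\<And>x. (\<Sum>i\<in>I. f i x) = 1"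
  obtains a :: "('a \<Rightarrow> 'i) \<Rightarrow> real" and b :: "'i \<Rightarrow> real" where
    "\<And>\<sigma>. 0 \<le> a \<sigma>" "\<And>\<sigma>. a \<sigma> > 0 \<Longrightarrow> \<exists>x. \<forall>g\<in>E. f (\<sigma> g) (g + x) > 0"
    "\<And>g i. g \<in> E \<Longrightarrow> i \<in> I \<Longrightarrow> (\<Sum>\<sigma> | \<sigma> \<in> PiE E (\<lambda>_. I) \<and> \<sigma> g = i. a \<sigma>) = b i"
    "(\<Sum>\<sigma>\<in>PiE E (\<lambda>_. I). a \<sigma>) = 1" "(\<Sum>i\<in>I. b i) = 1"
proof -
  obtain m :: "('a \<Rightarrow> real) \<Rightarrow> real" where
    m_add: "\<And>f h. f \<in> UC_b \<Longrightarrow> h \<in> UC_b \<Longrightarrow> m (\<lambda>x. f x + h x) = m f + m h" and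
    m_mult: "\<And>c f. f \<in> UC_b \<Longrightarrow> m (\<lambda>x. c * f x) = c * m f" and
    m_bounds: "\<And>f. f \<in> UC_b \<Longrightarrow> (INF x. f x) \<le> m f" "\<And>f. f \<in> UC_b \<Longrightarrow> m f \<le> (SUP x. f x)" and
    m_inv: "\<And>f g. f \<in> UC_b \<Longrightarrow> m (f \<circ> (\<lambda>x. g + x)) = m f"
    using assms(1) unfolding amenable_group_def by blast
  have m_const: "m (\<lambda>x. c) = c" for c
    using m_bounds[OF UC_b_const[of c]] by simp
  have m_sum: "m (\<lambda>x. \<Sum>j\<in>S. h j x) = (\<Sum>j\<in>S. m (h j))" if "\<And>j. h j \<in> UC_b" for S :: "'j set" and h
  proof (induction S rule: infinite_finite_induct)
    case (insert j S)
    then show ?case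
      using m_add[OF that[of j] UC_b_sum[of S h]] that by simp
  qed (use m_const[of 0] in simp_all)
  have m_nonneg: "0 \<le> m h" if "h \<in> UC_b" "\<And>x. 0 \<le> h x" for h
    using m_bounds(1)[OF that(1)] cINF_greatest[of UNIV 0 h] that(2) by fastforce
  have m_nonpos: "m h \<le> 0" if "h \<in> UC_b" "\<And>x. h x \<le> 0" for h
    using m_bounds(2)[OF that(1)] cSUP_least[of UNIV h 0] that(2) by fastforce
  define \<psi> where "\<psi> \<sigma> x = (\<Prod>g\<in>E. f (\<sigma> g) (g + x))" for \<sigma> x
  have \<psi>_UC: "\<psi> \<sigma> \<in> UC_b" for \<sigma>
    unfolding \<psi>_def by (intro UC_b_prod UC_b_left_translate f(1))
  have \<psi>_nonneg: "0 \<le> \<psi> \<sigma> x" for \<sigma> x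
    unfolding \<psi>_def by (intro prod_nonneg) (use f(2) in auto)
  have "\<exists>x. \<forall>g\<in>E. f (\<sigma> g) (g + x) > 0" if pos: "m (\<psi> \<sigma>) > 0" for \<sigma>
  proof -
    from pos obtain x where "\<psi> \<sigma> x \<noteq> 0"
      using m_nonpos[OF \<psi>_UC, of \<sigma>] by fastforce
    then have "\<forall>g\<in>E. f (\<sigma> g) (g + x) \<noteq> 0"
      using assms(3) by (auto simp: \<psi>_def)
    then have "\<forall>g\<in>E. f (\<sigma> g) (g + x) > 0"
      using f(2) by (simp add: order_less_le)
    then show ?thesis ..
  qed
  moreover have "(\<Sum>\<sigma> | \<sigma> \<in> PiE E (\<lambda>_. I) \<and> \<sigma> g = i. m (\<psi> \<sigma>)) = m (f i)" if g: "g \<in> E" and i: "i \<in> I" for g i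
  proof -
    have "(\<Sum>\<sigma> | \<sigma> \<in> PiE E (\<lambda>_. I) \<and> \<sigma> g = i. \<psi> \<sigma> x) = f i (g + x)" for x
    proof -
      \<comment> \<open>Suppressing the summands with \<open>\<sigma> g \<noteq> i\<close> changes only the factor at \<open>g\<close>.\<close>
      let ?\<phi> = "\<lambda>h j. if h = g \<and> j \<noteq> i then 0 else f j (h + x)"
      have "(\<Sum>\<sigma> | \<sigma> \<in> PiE E (\<lambda>_. I) \<and> \<sigma> g = i. \<psi> \<sigma> x) = (\<Sum>\<sigma>\<in>PiE E (\<lambda>_. I). \<Prod>h\<in>E. ?\<phi> h (\<sigma> h))"
      proof (rule sum.mono_neutral_cong_left)
        show "finite (PiE E (\<lambda>_. I))"
          using assms(2,3) by (intro finite_PiE) auto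
        show "\<forall>\<sigma>\<in>PiE E (\<lambda>_. I) - {\<sigma> \<in> PiE E (\<lambda>_. I). \<sigma> g = i}. (\<Prod>h\<in>E. ?\<phi> h (\<sigma> h)) = 0"
          using g assms(3) by (auto intro!: prod_zero)
        show "\<psi> \<sigma> x = (\<Prod>h\<in>E. ?\<phi> h (\<sigma> h))" if "\<sigma> \<in> {\<sigma> \<in> PiE E (\<lambda>_. I). \<sigma> g = i}" for \<sigma>
          unfolding \<psi>_def using that by (intro prod.cong) auto
      qed auto
      also have "\<dots> = (\<Prod>h\<in>E. \<Sum>j\<in>I. ?\<phi> h j)"
        using assms(2,3) by (simp add: prod_sum_PiE)
      also have "\<dots> = (\<Prod>h\<in>E. if h = g then f i (g + x) else 1)"
      proof (rule prod.cong)
        fix h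
        show "(\<Sum>j\<in>I. ?\<phi> h j) = (if h = g then f i (g + x) else 1)"
        proof (cases "h = g")
          case True
          have "(\<Sum>j\<in>I. ?\<phi> h j) = (\<Sum>j\<in>I. if j = i then f i (g + x) else 0)"
            unfolding True by (intro sum.cong) auto
          also have "\<dots> = f i (g + x)"
            using i assms(2) by simp
          finally show ?thesis
            using True by simp
        qed (simp add: f(3))
      qed simp
      also have "\<dots> = f i (g + x)"
        using g assms(3) by simp
      finally show ?thesis .
    qed
    then have eq: "(\<lambda>x. \<Sum>\<sigma> | \<sigma> \<in> PiE E (\<lambda>_. I) \<and> \<sigma> g = i. \<psi> \<sigma> x) = f i \<circ> (\<lambda>x. g + x)"
      by auto
    show ?thesis
      unfolding m_sum[OF \<psi>_UC, symmetric] eq by (rule m_inv[OF f(1)])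
  qed
  moreover have "(\<Sum>\<sigma>\<in>PiE E (\<lambda>_. I). m (\<psi> \<sigma>)) = 1"
  proof -
    have "(\<Sum>\<sigma>\<in>PiE E (\<lambda>_. I). \<psi> \<sigma> x) = 1" for x
      unfolding \<psi>_def using prod_sum_PiE[of E "\<lambda>_. I" "\<lambda>g i. f i (g + x)"] assms(2,3) f(3) by simp
    then show ?thesis
      unfolding m_sum[OF \<psi>_UC, symmetric] by (simp add: m_const)
  qed
  moreover have "(\<Sum>i\<in>I. m (f i)) = 1"
    unfolding m_sum[OF f(1), symmetric] by (simp add: m_const f(3))
  ultimately show ?thesis
    using that[of "\<lambda>\<sigma>. m (\<psi> \<sigma>)" "\<lambda>i. m (f i)"] m_nonneg[OF \<psi>_UC \<psi>_nonneg] by blast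
qed

text \<open>
  The points are chosen one after the other: the earlier ones forbid only finitely many positions.
\<close>

lemma exists_points_with_distinct_translates:
  fixes A :: "'j \<Rightarrow> 'a::group_add set"
  assumes "finite J" "finite E" "\<And>j. j \<in> J \<Longrightarrow> infinite (A j)"
  shows "\<exists>x. (\<forall>j\<in>J. x j \<in> A j) \<and>
    (\<forall>j\<in>J. \<forall>k\<in>J. \<forall>g\<in>E. \<forall>h\<in>E. g + x j = h + x k \<longrightarrow> j = k \<and> g = h)"
  using assms(1,3)
proof (induction J rule: finite_induct)
  case (insert j J)
  then obtain x where x: "\<forall>k\<in>J. x k \<in> A k"
    "\<forall>k\<in>J. \<forall>l\<in>J. \<forall>g\<in>E. \<forall>h\<in>E. g + x k = h + x l \<longrightarrow> k = l \<and> g = h"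
    by auto
  define B where "B = (\<lambda>(g, h, k). - g + (h + x k)) ` (E \<times> E \<times> J)"
  have "finite B"
    unfolding B_def using insert.hyps(1) assms(2) by simp
  then obtain y where y: "y \<in> A j" "y \<notin> B"
    using insert.prems[of j] by (metis finite_subset insertI1 subsetI)
  have new: "g + y \<noteq> h + x k" if "g \<in> E" "h \<in> E" "k \<in> J" for g h k
  proof
    assume "g + y = h + x k"
    then have "y = - g + (h + x k)"
      by (metis minus_add_cancel)
    with that y(2) show False
      unfolding B_def by force
  qed
  show ?case
  proof (intro exI[of _ "x(j := y)"] conjI ballI impI)
    fix k assume "k \<in> insert j J"
    then show "(x(j := y)) k \<in> A k"
      using x(1) y(1) by auto
  next
    fix k l g h assume *: "k \<in> insert j J" "l \<in> insert j J" "g \<in> E" "h \<in> E"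
      "g + (x(j := y)) k = h + (x(j := y)) l"
    then show "k = l"
      using x(2) new new[symmetric] by (auto split: if_splits)
    with * show "g = h" by auto
  qed
qed simp

text \<open>
  For every selection \<open>\<sigma>\<close>, about \<open>M * a \<sigma>\<close> points are placed where all \<open>f (\<sigma> g) (g + x)\<close> are
  positive, so that \<open>g\<close> moves such a point into \<open>\<sigma> g\<close>. Because the marginals of \<open>a\<close> agree, every
  translate of the resulting set \<open>F\<close> has at most \<open>\<nu> U \<le> M * b U\<close> points counted in \<open>U\<close>; numbering
  them for each \<open>g\<close> and \<open>U\<close> and taking together the points with the same number \<open>l\<close> gives the sets
  \<open>T U l\<close>, at most \<open>M\<close> altogether. The two error terms do not depend on \<open>M\<close>.
\<close>

lemma amenable_imp_separated_set:
  fixes E :: "'a::{topological_group_add, t2_space} set"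
  assumes nondiscrete: "\<not> discrete (UNIV :: 'a set)" and amenable: "amenable_group TYPE('a)"
    and E: "finite E" "E \<noteq> {}" and \<U>: "\<U> \<in> finite_right_uniform_coverings"
  defines "\<J> \<equiv> coverings_join E (\<lambda>g. left_translate g \<U>)"
  shows "\<exists>F. finite F \<and> M \<le> card F + card (PiE E (\<lambda>_. \<J>)) \<and>
    uniform_complexity (coverings_join E (\<lambda>g. left_translate g (cut_out_covering F \<U>)))
      \<le> M + card \<J>"
proof -
  have \<J>_unif: "\<J> \<in> finite_right_uniform_coverings"
    unfolding \<J>_def by (rule coverings_join_left_translate_finite_uniform[OF E(1) \<U>])
  then have fin_\<J>: "finite \<J>"
    by (simp add: finite_right_uniform_coverings_def)
  let ?\<Sigma> = "PiE E (\<lambda>_. \<J>)"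
  have fin_\<Sigma>: "finite ?\<Sigma>"
    using E(1) fin_\<J> by (intro finite_PiE) auto
  obtain f :: "'a set \<Rightarrow> 'a \<Rightarrow> real" where f: "\<And>U. f U \<in> UC_b" "\<And>U x. 0 \<le> f U x"
    "\<And>x. (\<Sum>U\<in>\<J>. f U x) = 1" "\<And>U x. f U x \<noteq> 0 \<Longrightarrow> x \<in> U"
    using UC_b_partition_of_unity[OF \<J>_unif] by blast
  have f_interior: "x \<in> interior U" if "f U x > 0" for U x
  proof (rule interiorI)
    show "open (f U -` {0<..})"
      by (intro open_vimage UC_b_continuous f(1)) simp
    show "f U -` {0<..} \<subseteq> U"
      using f(4) by force
  qed (use that in simp)
  obtain a :: "('a \<Rightarrow> 'a set) \<Rightarrow> real" and b :: "'a set \<Rightarrow> real" where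
    a: "\<And>\<sigma>. 0 \<le> a \<sigma>" "\<And>\<sigma>. a \<sigma> > 0 \<Longrightarrow> \<exists>x. \<forall>g\<in>E. f (\<sigma> g) (g + x) > 0" and
    marginal: "\<And>g U. g \<in> E \<Longrightarrow> U \<in> \<J> \<Longrightarrow> (\<Sum>\<sigma> | \<sigma> \<in> ?\<Sigma> \<and> \<sigma> g = U. a \<sigma>) = b U" and
    total: "(\<Sum>\<sigma>\<in>?\<Sigma>. a \<sigma>) = 1" "(\<Sum>U\<in>\<J>. b U) = 1"
    using amenable_marginals[OF amenable fin_\<J> E(1) f(1,2,3)] by blast
  have b_nonneg: "0 \<le> b U" if "U \<in> \<J>" for U
  proof -
    obtain g where "g \<in> E" using E(2) by blast
    then show ?thesis
      using marginal[of g U] that a(1) by (metis (no_types, lifting) sum_nonneg)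
  qed
  define A where "A \<sigma> = {x. \<forall>g\<in>E. f (\<sigma> g) (g + x) > 0}" for \<sigma>
  have A_infinite: "infinite (A \<sigma>)" if "a \<sigma> > 0" for \<sigma>
  proof -
    have "A \<sigma> = (\<Inter>g\<in>E. (\<lambda>x. f (\<sigma> g) (g + x)) -` {0<..})"
      by (auto simp: A_def)
    moreover have "open \<dots>"
      using E(1) by (intro open_INT ballI open_vimage UC_b_continuous UC_b_left_translate f(1)) auto
    ultimately have "open (A \<sigma>)" by simp
    moreover have "A \<sigma> \<noteq> {}"
      using a(2)[OF that] by (auto simp: A_def)
    ultimately show ?thesis
      using open_infinite_of_nondiscrete[OF nondiscrete] by blast
  qed
  define \<mu> where "\<mu> \<sigma> = nat \<lfloor>real M * a \<sigma>\<rfloor>" for \<sigma>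
  have \<mu>: "real (\<mu> \<sigma>) \<le> real M * a \<sigma>" "real M * a \<sigma> \<le> real (\<mu> \<sigma>) + 1" for \<sigma>
    using a(1)[of \<sigma>] unfolding \<mu>_def by (simp_all add: of_nat_nat)
  define J where "J = Sigma ?\<Sigma> (\<lambda>\<sigma>. {..<\<mu> \<sigma>})"
  have fin_J: "finite J"
    unfolding J_def using fin_\<Sigma> by simp
  have "infinite (A (fst j))" if "j \<in> J" for j
  proof (rule A_infinite)
    from that have "\<mu> (fst j) > 0" by (auto simp: J_def)
    then show "a (fst j) > 0"
      using a(1)[of "fst j"] by (cases "a (fst j) = 0") (auto simp: \<mu>_def)
  qed
  then obtain x where x: "\<And>j. j \<in> J \<Longrightarrow> x j \<in> A (fst j)"
    and x_distinct: "\<And>j k g h. j \<in> J \<Longrightarrow> k \<in> J \<Longrightarrow> g \<in> E \<Longrightarrow> h \<in> E \<Longrightarrow> g + x j = h + x k \<Longrightarrow> j = k \<and> g = h"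
    using exists_points_with_distinct_translates[OF fin_J E(1), of "\<lambda>j. A (fst j)"] by metis
  define F where "F = x ` J"
  have "finite F"
    unfolding F_def using fin_J by simp
  have "M \<le> card F + card ?\<Sigma>"
  proof -
    obtain g where "g \<in> E" using E(2) by blast
    then have "inj_on x J"
      using x_distinct by (metis inj_onI)
    then have "card F = (\<Sum>\<sigma>\<in>?\<Sigma>. \<mu> \<sigma>)"
      unfolding F_def J_def using fin_\<Sigma> by (simp add: card_image card_SigmaI)
    moreover have "real M = (\<Sum>\<sigma>\<in>?\<Sigma>. real M * a \<sigma>)"
      using total(1) by (simp add: sum_distrib_left[symmetric])
    moreover have "\<dots> \<le> (\<Sum>\<sigma>\<in>?\<Sigma>. real (\<mu> \<sigma>) + 1)"
      by (intro sum_mono \<mu>(2))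
    ultimately have "real M \<le> real (card F + card ?\<Sigma>)"
      by (simp add: sum.distrib)
    then show ?thesis by linarith
  qed
  moreover have "uniform_complexity (coverings_join E (\<lambda>g. left_translate g (cut_out_covering F \<U>)))
      \<le> M + card \<J>"
  proof -
    define \<nu> where "\<nu> U = nat \<lfloor>real M * b U\<rfloor>" for U
    \<comment> \<open>The indices of the points that \<open>g\<close> moves into \<open>U\<close> according to their selection.\<close>
    define K where "K g U = {j \<in> J. fst j g = U}" for g U
    have fin_K: "finite (K g U)" for g U
      unfolding K_def using fin_J by simp
    have card_K: "card (K g U) \<le> \<nu> U" if "g \<in> E" "U \<in> \<J>" for g U
    proof -
      have "K g U = Sigma {\<sigma> \<in> ?\<Sigma>. \<sigma> g = U} (\<lambda>\<sigma>. {..<\<mu> \<sigma>})"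
        by (auto simp: K_def J_def)
      then have "card (K g U) = (\<Sum>\<sigma> | \<sigma> \<in> ?\<Sigma> \<and> \<sigma> g = U. \<mu> \<sigma>)"
        using fin_\<Sigma> by (simp add: card_SigmaI)
      then have "real (card (K g U)) \<le> (\<Sum>\<sigma> | \<sigma> \<in> ?\<Sigma> \<and> \<sigma> g = U. real M * a \<sigma>)"
        using \<mu>(1) by (simp add: sum_mono)
      also have "\<dots> = real M * b U"
        using marginal[OF that] by (simp add: sum_distrib_left[symmetric])
      finally show ?thesis
        unfolding \<nu>_def by (simp add: le_nat_floor)
    qed
    have "\<exists>e. bij_betw e {..<card (K g U)} (K g U)" for g U
      using ex_bij_betw_nat_finite[OF fin_K] by (metis atLeast0LessThan)
    then obtain e where e: "\<And>g U. bij_betw (e g U) {..<card (K g U)} (K g U)"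
      by metis
    have e_mem: "e g U l \<in> K g U" if "l < card (K g U)" for g U l
      using e[of g U] that by (auto dest: bij_betwE)
    define T where "T U l = {g + x (e g U l) | g. g \<in> E \<and> l < card (K g U)}" for U l
    define \<T> where "\<T> = (\<lambda>(U, l). (T U l, U)) ` Sigma \<J> (\<lambda>U. {..<\<nu> U})"
    have "uniform_complexity (coverings_join E (\<lambda>g. left_translate g (cut_out_covering F \<U>)))
        \<le> card \<J> + card \<T>"
      unfolding \<J>_def
    proof (rule uniform_complexity_join_cut_out_covering_le[OF \<U> \<open>finite F\<close> E(1)])
      show "finite \<T>"
        unfolding \<T>_def using fin_\<J> by simp
    next
      fix S U assume "(S, U) \<in> \<T>"
      then show "U \<in> coverings_join E (\<lambda>g. left_translate g \<U>)"
        by (auto simp: \<T>_def \<J>_def)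
    next
      fix S U g assume "(S, U) \<in> \<T>" and g: "g \<in> E"
      then obtain l where S: "S = T U l" by (auto simp: \<T>_def)
      have "q = g + x (e g U l)" if "q \<in> T U l \<inter> (\<lambda>x. g + x) ` F" for q
      proof -
        from that obtain h k where h: "h \<in> E" "l < card (K h U)" "q = h + x (e h U l)"
          and k: "k \<in> J" "q = g + x k"
          by (auto simp: T_def F_def)
        have "e h U l \<in> J"
          using e_mem[OF h(2)] by (simp add: K_def)
        then have "h = g"
          using x_distinct[of "e h U l" k h g] h k g by auto
        with h(3) show ?thesis by simp
      qed
      then show "\<exists>q. S \<inter> (\<lambda>x. g + x) ` F \<subseteq> {q}"
        unfolding S by blast
    next
      fix g y assume g: "g \<in> E" and "y \<in> F"
      then obtain j where j: "j \<in> J" "y = x j" by (auto simp: F_def)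
      define U where "U = fst j g"
      have "U \<in> \<J>"
        using j(1) g by (auto simp: U_def J_def)
      have "j \<in> K g U"
        using j(1) by (simp add: K_def U_def)
      then obtain l where l: "l < card (K g U)" "j = e g U l"
        using e[of g U] by (auto simp: bij_betw_def)
      have "(T U l, U) \<in> \<T>"
        using l(1) card_K[OF g \<open>U \<in> \<J>\<close>] \<open>U \<in> \<J>\<close> by (force simp: \<T>_def)
      moreover have "g + y \<in> T U l"
        using g l j(2) by (auto simp: T_def)
      moreover have "g + y \<in> interior U"
        using x[OF j(1)] g j(2) by (auto simp: A_def U_def intro: f_interior)
      ultimately show "\<exists>T U. (T, U) \<in> \<T> \<and> g + y \<in> T \<and> g + y \<in> interior U" by blast
    qed
    moreover have "card \<T> \<le> M"
    proof -
      have "card \<T> \<le> card (Sigma \<J> (\<lambda>U. {..<\<nu> U}))"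
        unfolding \<T>_def using fin_\<J> by (intro card_image_le) simp
      also have "\<dots> = (\<Sum>U\<in>\<J>. \<nu> U)"
        using fin_\<J> by (simp add: card_SigmaI)
      finally have "real (card \<T>) \<le> (\<Sum>U\<in>\<J>. real (\<nu> U))"
        by (metis of_nat_le_iff of_nat_sum)
      also have "\<dots> \<le> (\<Sum>U\<in>\<J>. real M * b U)"
        using b_nonneg by (intro sum_mono) (simp add: \<nu>_def of_nat_nat)
      also have "\<dots> = real M"
        using total(2) by (simp add: sum_distrib_left[symmetric])
      finally show ?thesis by simp
    qed
    ultimately show ?thesis by linarith
  qed
  ultimately show ?thesis
    using \<open>finite F\<close> by blast
qed

lemma amenable_imp_small_ratio:
  fixes E :: "'a::{topological_group_add, t2_space} set"
  assumes "\<not> discrete (UNIV :: 'a set)" "amenable_group TYPE('a)" "finite E"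
    and \<U>: "\<U> \<in> finite_right_uniform_coverings" and "\<epsilon> > 0"
  shows "\<exists>\<V>\<in>finite_right_uniform_coverings. \<U> \<preceq> \<V> \<and>
    real (uniform_complexity (coverings_join E (\<lambda>g. left_translate g \<V>)))
      \<le> (1 + \<epsilon>) * real (uniform_complexity \<V>)"
proof (cases "E = {}")
  case True
  have "coverings_join {} (\<lambda>g. left_translate g \<U>) = {UNIV}"
    by (simp add: coverings_join_def)
  moreover have "{UNIV :: 'a set} \<in> finite_right_uniform_coverings"
    by (auto simp: finite_right_uniform_coverings_def right_uniform_covering_iff intro: exI[of _ UNIV])
  then have "uniform_complexity {UNIV :: 'a set} \<le> 1"
    using uniform_complexity_le[OF _ refined_by_refl] by fastforce
  moreover have "1 \<le> real (uniform_complexity \<U>)"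
    using uniform_complexity_pos[OF \<U>] by simp
  then have "1 \<le> (1 + \<epsilon>) * real (uniform_complexity \<U>)"
    using \<open>\<epsilon> > 0\<close> mult_mono[of 1 "1 + \<epsilon>" 1 "real (uniform_complexity \<U>)"] by simp
  ultimately show ?thesis
    unfolding True using \<U> refined_by_refl by (intro bexI[of _ \<U>]) auto
next
  case False
  define \<J> where "\<J> = coverings_join E (\<lambda>g. left_translate g \<U>)"
  define C where "C = card (PiE E (\<lambda>_. \<J>))"
  \<comment> \<open>Large enough for \<open>M + card \<J> \<le> (1 + \<epsilon>) * (M - C)\<close>.\<close>
  obtain M :: nat where M: "(card \<J> + (1 + \<epsilon>) * C) / \<epsilon> \<le> M"
    using real_arch_simple by blast
  obtain F where F: "finite F" "M \<le> card F + C"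
    "uniform_complexity (coverings_join E (\<lambda>g. left_translate g (cut_out_covering F \<U>))) \<le> M + card \<J>"
    using amenable_imp_separated_set[OF assms(1-3) False \<U>, of M] unfolding C_def \<J>_def by blast
  have "real (uniform_complexity (coverings_join E (\<lambda>g. left_translate g (cut_out_covering F \<U>))))
      \<le> real M + real (card \<J>)"
    using F(3) by (metis of_nat_add of_nat_le_iff)
  also have "\<dots> \<le> (1 + \<epsilon>) * (real M - real C)"
    using M \<open>\<epsilon> > 0\<close> by (simp add: field_simps)
  also have "\<dots> \<le> (1 + \<epsilon>) * real (card F)"
    using F(2) \<open>\<epsilon> > 0\<close> by (intro mult_left_mono) auto
  also have "\<dots> \<le> (1 + \<epsilon>) * real (uniform_complexity (cut_out_covering F \<U>))"
    using card_le_uniform_complexity_cut_out_covering[OF \<U> F(1)] \<open>\<epsilon> > 0\<close> by (intro mult_left_mono) auto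
  finally show ?thesis
    using cut_out_covering_finite_uniform[OF \<U> F(1)] refined_by_cut_out_covering by blast
qed

section \<open>Invariant means from coverings\<close>

text \<open>The layer cake formula: integrate the hypothesis over \<open>t\<close> from \<open>0\<close> to \<open>b\<close>.\<close>

lemma sum_le_of_superlevel_card_le:
  fixes u v :: "'i \<Rightarrow> real"
  assumes "finite X" "0 \<le> b" "0 \<le> s"
    and u: "\<And>i. i \<in> X \<Longrightarrow> 0 \<le> u i" "\<And>i. i \<in> X \<Longrightarrow> u i \<le> b"
    and v: "\<And>i. i \<in> X \<Longrightarrow> 0 \<le> v i"
    and le: "\<And>t. real (card {i \<in> X. t \<le> u i}) \<le> real (card {i \<in> X. t - s \<le> v i}) + c"
  shows "sum u X \<le> sum v X + s * card X + b * c"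
proof -
  have layer: "((\<lambda>t. if t \<le> y then 1 else 0 :: real) has_integral min y b) {0..b}" if "0 \<le> y" for y
  proof -
    have "((\<lambda>t. 1 :: real) has_integral min y b) {0..min y b}"
      using has_integral_const_real[of "1::real" 0 "min y b"] that assms(2) by simp
    then have "((\<lambda>t. if t \<in> {0..min y b} then 1 else 0 :: real) has_integral min y b) {0..b}"
      by (subst has_integral_restrict) auto
    then show ?thesis
      by (rule has_integral_eq[rotated]) auto
  qed
  have count: "(\<Sum>i\<in>X. if t \<le> w i then 1 else 0 :: real) = card {i \<in> X. t \<le> w i}" for t and w :: "'i \<Rightarrow> real"
    using assms(1) by (simp add: sum.If_cases Int_def)
  have "((\<lambda>t. \<Sum>i\<in>X. if t \<le> u i then 1 else 0) has_integral (\<Sum>i\<in>X. min (u i) b)) {0..b}"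
    by (intro has_integral_sum assms(1) layer u(1))
  moreover have "((\<lambda>t. (\<Sum>i\<in>X. if t \<le> v i + s then 1 else 0) + c)
      has_integral ((\<Sum>i\<in>X. min (v i + s) b) + b * c)) {0..b}"
  proof (intro has_integral_add has_integral_sum assms(1) layer)
    show "((\<lambda>t. c) has_integral b * c) {0..b}"
      using has_integral_const_real[of c 0 b] assms(2) by simp
  qed (use v assms(3) in \<open>auto intro: add_nonneg_nonneg\<close>)
  ultimately have "(\<Sum>i\<in>X. min (u i) b) \<le> (\<Sum>i\<in>X. min (v i + s) b) + b * c"
  proof (rule has_integral_le)
    fix t
    show "(\<Sum>i\<in>X. if t \<le> u i then 1 else 0) \<le> (\<Sum>i\<in>X. if t \<le> v i + s then 1 else 0) + c"
      unfolding count using le[of t] by (simp add: diff_le_eq)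
  qed
  moreover have "(\<Sum>i\<in>X. min (u i) b) = sum u X"
    using u(2) by (intro sum.cong) auto
  moreover have "(\<Sum>i\<in>X. min (v i + s) b) \<le> (\<Sum>i\<in>X. v i + s)"
    by (intro sum_mono) auto
  ultimately show ?thesis
    by (simp add: sum.distrib mult.commute)
qed

text \<open>
  The set \<open>w\<close> lies in \<open>g (V w g)\<close>, so \<open>- g + x w\<close> is a point of \<open>V w g\<close>. Let \<open>S\<close> be the set of
  those \<open>w\<close> with \<open>f (- g + x w) \<ge> t\<close>. The sets \<open>V w g\<close> with \<open>w \<notin> S\<close>, together with the \<open>V w h\<close> with
  \<open>f (- h + x w) \<ge> t - 2 * d\<close>, still form a uniform covering: wherever a \<open>V w g\<close> with \<open>w \<in> S\<close> is left
  out, the values of \<open>f\<close> are at least \<open>t - d\<close>, and so every \<open>V w' h\<close> containing such a place has been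
  included. This covering has no fewer members than the complexity of \<open>\<V>\<close>, which compares the
  superlevel sets for \<open>g\<close> and \<open>h\<close>.
\<close>

lemma almost_invariant_of_small_ratio:
  fixes E :: "'a::topological_group_add set"
  assumes E: "finite E" "E \<noteq> {}" and \<V>: "\<V> \<in> finite_right_uniform_coverings"
    and ratio: "real (uniform_complexity (coverings_join E (\<lambda>g. left_translate g \<V>)))
      \<le> (1 + \<epsilon>) * real (uniform_complexity \<V>)" and "0 \<le> \<epsilon>"
  shows "\<exists>(X :: 'a set set) x. finite X \<and> X \<noteq> {} \<and>
    (\<forall>g\<in>E. \<forall>h\<in>E. \<forall>f b d. (\<forall>y. 0 \<le> f y \<and> f y \<le> b) \<longrightarrow>
      (\<forall>V\<in>\<V>. \<forall>y\<in>V. \<forall>z\<in>V. \<bar>f y - f z\<bar> \<le> d) \<longrightarrow> 0 \<le> d \<longrightarrow>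
      (\<Sum>w\<in>X. f (- g + x w)) \<le> (\<Sum>w\<in>X. f (- h + x w)) + (2 * d + b * \<epsilon>) * card X)"
proof -
  let ?\<J> = "coverings_join E (\<lambda>g. left_translate g \<V>)"
  define n where "n = uniform_complexity \<V>"
  obtain X' where X': "X' \<in> finite_right_uniform_coverings" "?\<J> \<preceq> X'" "card X' = uniform_complexity ?\<J>"
    by (rule uniform_complexity_attained[OF coverings_join_left_translate_finite_uniform[OF E(1) \<V>]])
  define X where "X = X' - {{}}"
  have X: "finite X" "right_uniform_covering X"
    using X'(1) right_uniform_covering_remove_empty
    by (auto simp: X_def finite_right_uniform_coverings_def)
  have "card X \<le> card X'"
    using X'(1) unfolding X_def finite_right_uniform_coverings_def by (intro card_mono) auto
  then have card_X: "real (card X) \<le> (1 + \<epsilon>) * n"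
    using ratio X'(3) by (simp add: n_def)
  have "\<exists>V. \<forall>g\<in>E. V g \<in> \<V> \<and> w \<subseteq> (\<lambda>x. g + x) ` V g" if w: "w \<in> X" for w
  proof -
    obtain A where A: "A \<in> ?\<J>" "w \<subseteq> A"
      using X'(2) w unfolding refined_by_def X_def by blast
    then obtain V where "A = (\<Inter>g\<in>E. (\<lambda>x. g + x) ` V g)" "\<forall>g\<in>E. V g \<in> \<V>"
      unfolding coverings_join_left_translate_iff by blast
    with A(2) show ?thesis
      by (intro exI[of _ V]) blast
  qed
  then obtain V where V: "\<And>w g. w \<in> X \<Longrightarrow> g \<in> E \<Longrightarrow> V w g \<in> \<V>"
    and V_trans: "\<And>w g. w \<in> X \<Longrightarrow> g \<in> E \<Longrightarrow> w \<subseteq> (\<lambda>x. g + x) ` V w g"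
    by metis
  have V_sub: "- g + y \<in> V w g" if "w \<in> X" "g \<in> E" "y \<in> w" for w g y
    using V_trans[OF that(1,2)] that(3) by auto
  obtain x where x: "\<And>w. w \<in> X \<Longrightarrow> x w \<in> w"
    by (metis X_def DiffE ex_in_conv singletonI)
  have V_unif: "right_uniform_covering ((\<lambda>w. V w g) ` X)" if "g \<in> E" for g
  proof (rule right_uniform_covering_coarser)
    show "right_uniform_covering (left_translate (- g) X)"
      by (rule right_uniform_covering_left_translate[OF X(2)])
    show "(\<lambda>w. V w g) ` X \<preceq> left_translate (- g) X"
      unfolding refined_by_def
    proof
      fix A assume "A \<in> left_translate (- g) X"
      then obtain w where "w \<in> X" "A = (\<lambda>x. - g + x) ` w"
        by (auto simp: left_translate_def)
      then show "\<exists>U\<in>(\<lambda>w. V w g) ` X. A \<subseteq> U"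
        using V_sub[OF _ that] by (intro bexI[of _ "V w g"]) auto
    qed
  qed
  have n_le: "n \<le> card \<C>" if "finite \<C>" "right_uniform_covering \<C>" "\<C> \<subseteq> \<V>" for \<C>
    unfolding n_def using that
    by (intro uniform_complexity_le) (auto simp: finite_right_uniform_coverings_def refined_by_def)
  have n_card_X: "n \<le> card X"
  proof -
    obtain g where g: "g \<in> E" using E(2) by blast
    have "n \<le> card ((\<lambda>w. V w g) ` X)"
      using X(1) V_unif[OF g] V g by (intro n_le) auto
    also have "\<dots> \<le> card X"
      using X(1) by (rule card_image_le)
    finally show ?thesis .
  qed
  have "n > 0"
    unfolding n_def by (rule uniform_complexity_pos[OF \<V>])
  have superlevel: "card {w \<in> X. t \<le> f (- g + x w)} + n \<le> card {w \<in> X. t - 2 * d \<le> f (- h + x w)} + card X"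
    if g: "g \<in> E" and h: "h \<in> E" and f: "\<forall>V\<in>\<V>. \<forall>y\<in>V. \<forall>z\<in>V. \<bar>f y - f z\<bar> \<le> d"
    for g h d t and f :: "'a \<Rightarrow> real"
  proof -
    define S where "S = {w \<in> X. t \<le> f (- g + x w)}"
    define S' where "S' = {w \<in> X. t - 2 * d \<le> f (- h + x w)}"
    let ?\<C> = "(\<lambda>w. V w g) ` (X - S) \<union> (\<lambda>w. V w h) ` S'"
    obtain A where A: "open A" "0 \<in> A" "\<And>y. \<exists>U\<in>(\<lambda>w. V w g) ` X. \<forall>a\<in>A. a + y \<in> U"
      using V_unif[OF g] unfolding right_uniform_covering_iff by blast
    obtain B where B: "open B" "0 \<in> B" "\<And>y. \<exists>U\<in>(\<lambda>w. V w h) ` X. \<forall>a\<in>B. a + y \<in> U"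
      using V_unif[OF h] unfolding right_uniform_covering_iff by blast
    have "\<exists>U\<in>?\<C>. \<forall>a\<in>A \<inter> B. a + y \<in> U" for y
    proof -
      obtain w where w: "w \<in> X" "\<forall>a\<in>A. a + y \<in> V w g" using A(3)[of y] by auto
      obtain w' where w': "w' \<in> X" "\<forall>a\<in>B. a + y \<in> V w' h" using B(3)[of y] by auto
      show ?thesis
      proof (cases "w \<in> S")
        case False
        then show ?thesis
          using w by (intro bexI[of _ "V w g"]) auto
      next
        case True
        have "y \<in> V w g" "y \<in> V w' h"
          using w(2) w'(2) A(2) B(2) by (metis add_0)+
        then have "\<bar>f (- g + x w) - f y\<bar> \<le> d" "\<bar>f (- h + x w') - f y\<bar> \<le> d"
          using f V[OF w(1) g] V[OF w'(1) h] V_sub[OF w(1) g x[OF w(1)]] V_sub[OF w'(1) h x[OF w'(1)]]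
          by blast+
        then have "w' \<in> S'"
          using True w'(1) unfolding S_def S'_def by auto
        then show ?thesis
          using w' by (intro bexI[of _ "V w' h"]) auto
      qed
    qed
    then have "right_uniform_covering ?\<C>"
      unfolding right_uniform_covering_iff using A(1,2) B(1,2) by (intro exI[of _ "A \<inter> B"]) auto
    moreover have "?\<C> \<subseteq> \<V>"
      using V g h by (auto simp: S_def S'_def)
    moreover have fin: "finite S'" "finite (X - S)"
      using X(1) by (auto simp: S'_def)
    ultimately have "n \<le> card ?\<C>"
      by (intro n_le) auto
    also have "\<dots> \<le> card (X - S) + card S'"
      using card_Un_le[of "(\<lambda>w. V w g) ` (X - S)" "(\<lambda>w. V w h) ` S'"]
        card_image_le[OF fin(1), of "\<lambda>w. V w h"] card_image_le[OF fin(2), of "\<lambda>w. V w g"] by linarith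
    also have "card (X - S) = card X - card S"
      using X(1) by (intro card_Diff_subset) (auto simp: S_def)
    finally show ?thesis
      using card_mono[of X S] X(1) unfolding S_def[symmetric] S'_def[symmetric] by (auto simp: S_def)
  qed
  have inv: "(\<Sum>w\<in>X. f (- g + x w)) \<le> (\<Sum>w\<in>X. f (- h + x w)) + (2 * d + b * \<epsilon>) * card X"
    if gh: "g \<in> E" "h \<in> E" and f: "\<forall>y. 0 \<le> f y \<and> f y \<le> b" "\<forall>V\<in>\<V>. \<forall>y\<in>V. \<forall>z\<in>V. \<bar>f y - f z\<bar> \<le> d" "0 \<le> d"
    for g h b d and f :: "'a \<Rightarrow> real"
  proof -
    have "0 \<le> b" using f(1) by (meson order_trans)
    have "(\<Sum>w\<in>X. f (- g + x w)) \<le> (\<Sum>w\<in>X. f (- h + x w)) + 2 * d * card X + b * (real (card X) - n)"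
    proof (rule sum_le_of_superlevel_card_le[OF X(1) \<open>0 \<le> b\<close>])
      fix t
      have "real (card {w \<in> X. t \<le> f (- g + x w)} + n) \<le>
          real (card {w \<in> X. t - 2 * d \<le> f (- h + x w)} + card X)"
        using superlevel[OF gh f(2)] by (rule of_nat_mono)
      then show "real (card {w \<in> X. t \<le> f (- g + x w)})
          \<le> real (card {w \<in> X. t - 2 * d \<le> f (- h + x w)}) + (real (card X) - n)"
        by simp
    qed (use f in auto)
    also have "b * (real (card X) - n) \<le> b * (\<epsilon> * card X)"
    proof (rule mult_left_mono[OF _ \<open>0 \<le> b\<close>])
      have "\<epsilon> * n \<le> \<epsilon> * card X"
        using n_card_X \<open>0 \<le> \<epsilon>\<close> by (intro mult_left_mono) auto
      with card_X show "real (card X) - n \<le> \<epsilon> * card X"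
        by (simp add: distrib_right)
    qed
    finally show ?thesis
      by (simp add: algebra_simps)
  qed
  have "X \<noteq> {}"
    using n_card_X \<open>n > 0\<close> by auto
  with X(1) show ?thesis
    by (intro exI[of _ X] exI[of _ x] conjI ballI allI impI) (assumption | rule inv)+
qed

text \<open>
  Equivalent to the supremum of the infima of the quotients being at most \<open>1\<close>.
\<close>

definition almost_invariant_complexity :: "'a::topological_group_add itself \<Rightarrow> bool" where
  "almost_invariant_complexity _ \<longleftrightarrow>
     (\<forall>(E :: 'a set) \<epsilon>. \<forall>\<U>\<in>finite_right_uniform_coverings. finite E \<longrightarrow> \<epsilon> > 0 \<longrightarrow>
        (\<exists>\<V>\<in>finite_right_uniform_coverings. \<U> \<preceq> \<V> \<and>
          real (uniform_complexity (coverings_join E (\<lambda>g. left_translate g \<V>)))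
            \<le> (1 + \<epsilon>) * real (uniform_complexity \<V>)))"

text \<open>
  The bound \<open>2 * d + b * \<epsilon>\<close> for the defect of invariance is made equal to \<open>\<eta>\<close> by taking \<open>d = \<eta> / 4\<close> as
  the oscillation on the members of the covering and \<open>\<epsilon> = \<eta> / (4 * b)\<close>, where the bound for the
  shifted functions is \<open>2 * b\<close>.
\<close>

lemma almost_invariant_complexity_imp_almost_invariant_means:
  fixes F :: "('a::topological_group_add \<Rightarrow> real) set" and D :: "'a set"
  assumes "almost_invariant_complexity TYPE('a)"
    and F: "finite F" "F \<subseteq> UC_b" and "finite D" "\<eta> > 0"
  shows "\<exists>(X :: 'a set set) x. finite X \<and> X \<noteq> {} \<and>
    (\<forall>f\<in>F. \<forall>g\<in>D. \<bar>(\<Sum>w\<in>X. f (g + x w)) / card X - (\<Sum>w\<in>X. f (x w)) / card X\<bar> \<le> \<eta>)"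
proof -
  have "\<exists>b>0. \<forall>f\<in>F. \<forall>y. \<bar>f y\<bar> \<le> b"
  proof -
    have "bounded (\<Union>f\<in>F. range f)"
      using F by (intro bounded_UN) (auto simp: UC_b_iff)
    then show ?thesis
      unfolding bounded_pos by auto
  qed
  then obtain b where b: "b > 0" "\<And>f y. f \<in> F \<Longrightarrow> \<bar>f y\<bar> \<le> b" by blast
  obtain \<U> where \<U>: "\<U> \<in> finite_right_uniform_coverings"
    "\<And>U f x y. U \<in> \<U> \<Longrightarrow> f \<in> F \<Longrightarrow> x \<in> U \<Longrightarrow> y \<in> U \<Longrightarrow> \<bar>f x - f y\<bar> \<le> \<eta> / 4"
    using UC_b_small_oscillation[OF F, of "\<eta> / 4"] \<open>\<eta> > 0\<close> by auto
  define E where "E = insert 0 (uminus ` D)"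
  define \<epsilon> where "\<epsilon> = \<eta> / (4 * b)"
  have "\<epsilon> > 0" using \<open>\<eta> > 0\<close> b(1) by (simp add: \<epsilon>_def)
  have E: "finite E" "E \<noteq> {}" using \<open>finite D\<close> by (auto simp: E_def)
  obtain \<V> where \<V>: "\<V> \<in> finite_right_uniform_coverings" "\<U> \<preceq> \<V>"
    "real (uniform_complexity (coverings_join E (\<lambda>g. left_translate g \<V>)))
          \<le> (1 + \<epsilon>) * real (uniform_complexity \<V>)"
    using assms(1) E(1) \<U>(1) \<open>\<epsilon> > 0\<close> unfolding almost_invariant_complexity_def by blast
  obtain X :: "'a set set" and x where X: "finite X" "X \<noteq> {}" and
    inv: "\<forall>g\<in>E. \<forall>h\<in>E. \<forall>f b d. (\<forall>y. 0 \<le> f y \<and> f y \<le> b) \<longrightarrow>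
      (\<forall>V\<in>\<V>. \<forall>y\<in>V. \<forall>z\<in>V. \<bar>f y - f z\<bar> \<le> d) \<longrightarrow> 0 \<le> d \<longrightarrow>
      (\<Sum>w\<in>X. f (- g + x w)) \<le> (\<Sum>w\<in>X. f (- h + x w)) + (2 * d + b * \<epsilon>) * card X"
    using almost_invariant_of_small_ratio[OF E \<V>(1,3)] \<open>\<epsilon> > 0\<close> by (auto simp: less_imp_le)
  have le: "(\<Sum>w\<in>X. f (- g + x w)) \<le> (\<Sum>w\<in>X. f (- h + x w)) + \<eta> * card X"
    if f: "f \<in> F" and gh: "g \<in> E" "h \<in> E" for f g h
  proof -
    have osc: "\<bar>f y - f z\<bar> \<le> \<eta> / 4" if "V \<in> \<V>" "y \<in> V" "z \<in> V" for V y z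
      using \<V>(2) \<U>(2)[OF _ f] that unfolding refined_by_def by blast
    \<comment> \<open>Shifting \<open>f\<close> by \<open>b\<close> makes it nonnegative.\<close>
    have bound: "0 \<le> f y + b \<and> f y + b \<le> 2 * b" for y
      using b(2)[OF f, of y] by linarith
    have "(\<Sum>w\<in>X. f (- g + x w) + b) \<le> (\<Sum>w\<in>X. f (- h + x w) + b) + (2 * (\<eta> / 4) + 2 * b * \<epsilon>) * card X"
      using inv[rule_format, OF gh, of "\<lambda>y. f y + b" "2 * b" "\<eta> / 4"] bound osc \<open>\<eta> > 0\<close> by simp
    moreover have "2 * (\<eta> / 4) + 2 * b * \<epsilon> = \<eta>"
      using b(1) by (simp add: \<epsilon>_def)
    ultimately show ?thesis
      by (simp add: sum.distrib)
  qed
  have "\<bar>(\<Sum>w\<in>X. f (g + x w)) / card X - (\<Sum>w\<in>X. f (x w)) / card X\<bar> \<le> \<eta>" if f: "f \<in> F" and "g \<in> D" for f g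
  proof -
    have "- g \<in> E" "0 \<in> E" using \<open>g \<in> D\<close> by (auto simp: E_def)
    then have "(\<Sum>w\<in>X. f (g + x w)) \<le> (\<Sum>w\<in>X. f (x w)) + \<eta> * card X"
      "(\<Sum>w\<in>X. f (x w)) \<le> (\<Sum>w\<in>X. f (g + x w)) + \<eta> * card X"
      using le[OF f, of "- g" 0] le[OF f, of 0 "- g"] by simp_all
    then have "\<bar>(\<Sum>w\<in>X. f (g + x w)) - (\<Sum>w\<in>X. f (x w))\<bar> \<le> \<eta> * card X"
      by linarith
    moreover have "card X > 0"
      using X by (simp add: card_gt_0_iff)
    ultimately show ?thesis
      by (simp add: diff_divide_distrib[symmetric] abs_divide divide_le_eq)
  qed
  with X show ?thesis by blast
qed

text \<open>
  Functionals with values between infimum and supremum form a compact product of intervals by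
  Tychonoff's theorem, and linearity and approximate invariance are closed conditions. Finitely many
  of them are satisfied by an average over finitely many points.
\<close>

lemma almost_invariant_complexity_imp_amenable:
  assumes "almost_invariant_complexity TYPE('a::topological_group_add)"
  shows "amenable_group TYPE('a)"
proof -
  \<comment> \<open>The value \<open>0\<close> outside \<open>UC_b\<close> is a convention that makes the product compact.\<close>
  define R where "R f = (if f \<in> UC_b then {INF x. f x..SUP x. f x} else {0})" for f :: "'a \<Rightarrow> real"
  have "compact (PiE UNIV R)"
  proof -
    have "compactin (product_topology (\<lambda>_. euclidean) UNIV) (PiE UNIV R)"
      unfolding compactin_PiE by (simp add: R_def)
    then show ?thesis
      by (simp add: euclidean_product_topology compactin_euclidean_iff)
  qed
  define L where "L = (\<Inter>f\<in>UC_b. \<Inter>h\<in>UC_b. {m :: ('a \<Rightarrow> real) \<Rightarrow> real. m (\<lambda>x. f x + h x) = m f + m h}) \<inter>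
    (\<Inter>c. \<Inter>f\<in>UC_b. {m. m (\<lambda>x. c * f x) = c * m f})"
  have ev: "continuous_on UNIV (\<lambda>m :: ('a \<Rightarrow> real) \<Rightarrow> real. m f)" for f
    by (rule continuous_on_product_coordinates)
  have "closed L"
    unfolding L_def by (intro closed_Int closed_INT ballI closed_Collect_eq continuous_intros ev)
  with \<open>compact (PiE UNIV R)\<close> have "compact (PiE UNIV R \<inter> L)"
    by (rule compact_Int_closed)
  define C where "C = (\<lambda>(f, g, \<eta>). {m :: ('a \<Rightarrow> real) \<Rightarrow> real. \<bar>m (f \<circ> (\<lambda>x. g + x)) - m f\<bar> \<le> \<eta>})"
  define I where "I = (UC_b :: ('a \<Rightarrow> real) set) \<times> (UNIV :: 'a set) \<times> {0 :: real<..}"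
  have "PiE UNIV R \<inter> L \<inter> (\<Inter>i\<in>I. C i) \<noteq> {}"
  proof (rule compact_imp_fip_image[OF \<open>compact (PiE UNIV R \<inter> L)\<close>])
    show "closed (C i)" if "i \<in> I" for i
      unfolding C_def by (cases i) (auto intro!: closed_Collect_le continuous_intros ev)
  next
    fix I' assume I': "finite I'" "I' \<subseteq> I"
    define \<eta> where "\<eta> = Min (insert 1 ((snd \<circ> snd) ` I'))"
    have "\<eta> > 0"
      unfolding \<eta>_def using I' by (subst Min_gr_iff) (auto simp: I_def)
    have \<eta>_le: "\<eta> \<le> snd (snd i)" if "i \<in> I'" for i
      unfolding \<eta>_def using I'(1) that by (intro Min_le) auto
    have fin: "finite (fst ` I')" "fst ` I' \<subseteq> UC_b" "finite ((fst \<circ> snd) ` I')"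
      using I' by (auto simp: I_def)
    obtain X :: "'a set set" and x where X: "finite X" "X \<noteq> {}" and
      inv: "\<forall>f\<in>fst ` I'. \<forall>g\<in>(fst \<circ> snd) ` I'.
        \<bar>(\<Sum>w\<in>X. f (g + x w)) / card X - (\<Sum>w\<in>X. f (x w)) / card X\<bar> \<le> \<eta>"
      using almost_invariant_complexity_imp_almost_invariant_means[OF assms fin \<open>\<eta> > 0\<close>]
      by (elim exE conjE) (rule that)
    have card_X: "real (card X) > 0"
      using X by (simp add: card_gt_0_iff)
    define m where "m f = (if f \<in> UC_b then (\<Sum>w\<in>X. f (x w)) / card X else 0)" for f :: "'a \<Rightarrow> real"
    have "m f \<in> R f" for f
    proof (cases "f \<in> UC_b")
      case True
      then have bdd: "bdd_above (range f)" "bdd_below (range f)"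
        by (auto simp: UC_b_iff bounded_imp_bdd_above bounded_imp_bdd_below)
      have "of_nat (card X) * (INF x. f x) \<le> (\<Sum>w\<in>X. f (x w))"
        by (intro sum_bounded_below cINF_lower bdd) simp
      moreover have "(\<Sum>w\<in>X. f (x w)) \<le> of_nat (card X) * (SUP x. f x)"
        by (intro sum_bounded_above cSUP_upper bdd) simp
      ultimately show ?thesis
        using True card_X by (simp add: R_def m_def pos_le_divide_eq pos_divide_le_eq mult.commute)
    qed (simp add: R_def m_def)
    then have "m \<in> PiE UNIV R" by auto
    moreover have "m \<in> L"
      unfolding L_def
    proof (intro IntI INT_I CollectI)
      show "m (\<lambda>x. f x + h x) = m f + m h" if "f \<in> UC_b" "h \<in> UC_b" for f h
        using that UC_b_add[OF that] by (simp add: m_def sum.distrib add_divide_distrib)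
      show "m (\<lambda>x. c * f x) = c * m f" if "f \<in> UC_b" for c f
        using that UC_b_mult[OF UC_b_const that] by (simp add: m_def sum_distrib_left[symmetric])
    qed
    moreover have "m \<in> C i" if "i \<in> I'" for i
    proof -
      obtain f g e where i: "i = (f, g, e)" by (cases i) auto
      with that I'(2) have f: "f \<in> UC_b" by (auto simp: I_def)
      then have "f \<circ> (\<lambda>x. g + x) \<in> UC_b"
        using UC_b_left_translate by (simp add: o_def)
      moreover have "\<bar>(\<Sum>w\<in>X. f (g + x w)) / card X - (\<Sum>w\<in>X. f (x w)) / card X\<bar> \<le> e"
      proof -
        have "f \<in> fst ` I'" "g \<in> (fst \<circ> snd) ` I'"
          using that by (force simp: i)+
        with inv have "\<bar>(\<Sum>w\<in>X. f (g + x w)) / card X - (\<Sum>w\<in>X. f (x w)) / card X\<bar> \<le> \<eta>"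
          by blast
        also have "\<eta> \<le> e"
          using \<eta>_le[OF that] by (simp add: i)
        finally show ?thesis .
      qed
      ultimately show ?thesis
        using f by (simp add: C_def i m_def)
    qed
    ultimately show "PiE UNIV R \<inter> L \<inter> (\<Inter>i\<in>I'. C i) \<noteq> {}" by blast
  qed
  then obtain m where m: "m \<in> PiE UNIV R" "m \<in> L" "\<And>i. i \<in> I \<Longrightarrow> m \<in> C i" by blast
  have bounds: "(INF x. f x) \<le> m f \<and> m f \<le> (SUP x. f x)" if "f \<in> UC_b" for f
  proof -
    have "m f \<in> R f" using m(1) by auto
    with that show ?thesis by (simp add: R_def)
  qed
  have inv: "m (f \<circ> (\<lambda>x. g + x)) = m f" if f: "f \<in> UC_b" for f g
  proof -
    have "\<bar>m (f \<circ> (\<lambda>x. g + x)) - m f\<bar> \<le> 0 + e" if "e > 0" for e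
      using m(3)[of "(f, g, e)"] f that by (simp add: I_def C_def)
    then have "\<bar>m (f \<circ> (\<lambda>x. g + x)) - m f\<bar> \<le> 0"
      by (rule field_le_epsilon)
    then show ?thesis by simp
  qed
  have "m (\<lambda>x. f x + h x) = m f + m h" if "f \<in> UC_b" "h \<in> UC_b" for f h
    using m(2) that unfolding L_def by blast
  moreover have "m (\<lambda>x. c * f x) = c * m f" if "f \<in> UC_b" for c f
    using m(2) that unfolding L_def by blast
  ultimately show ?thesis
    unfolding amenable_group_def using bounds inv by (intro exI[of _ m]) blast
qed

section \<open>The characterisation of amenability\<close>

theorem corollary7p4:
  assumes "\<not> discrete (UNIV :: 'a::{topological_group_add, t2_space} set)"
  shows "amenable_group TYPE('a) \<longleftrightarrow>
    (SUP E\<in>{E :: 'a set. finite E}.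
      SUP \<U>\<in>(finite_right_uniform_coverings :: 'a set set set).
        Inf {ereal (real (uniform_complexity (coverings_join E (\<lambda>g. left_translate g \<V>)))
                    / real (uniform_complexity \<V>))
            | \<V>. \<V> \<in> finite_right_uniform_coverings \<and> \<U> \<preceq> \<V>}) = 1"
proof -
  let ?N = "\<lambda>\<U> :: 'a set set. real (uniform_complexity \<U>)"
  let ?J = "\<lambda>(E :: 'a set) \<V>. coverings_join E (\<lambda>g. left_translate g \<V>)"
  define Q where "Q E \<U> = Inf {ereal (?N (?J E \<V>) / ?N \<V>) | \<V>.
    \<V> \<in> finite_right_uniform_coverings \<and> \<U> \<preceq> \<V>}" for E \<U>
  have ratio_le_iff: "?N (?J E \<V>) / ?N \<V> \<le> 1 + \<epsilon> \<longleftrightarrow> ?N (?J E \<V>) \<le> (1 + \<epsilon>) * ?N \<V>"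
    if "\<V> \<in> finite_right_uniform_coverings" for E \<V> \<epsilon>
    using uniform_complexity_pos[OF that] by (simp add: pos_divide_le_eq)
  have Q_le_iff: "Q E \<U> \<le> 1 \<longleftrightarrow> (\<forall>\<epsilon>>0. \<exists>\<V>\<in>finite_right_uniform_coverings. \<U> \<preceq> \<V> \<and>
      ?N (?J E \<V>) \<le> (1 + \<epsilon>) * ?N \<V>)" (is "_ \<longleftrightarrow> ?R") for E \<U>
  proof
    assume Q: "Q E \<U> \<le> 1"
    show ?R
    proof (intro allI impI)
      fix \<epsilon> :: real assume "\<epsilon> > 0"
      then have "(1 :: ereal) < ereal (1 + \<epsilon>)"
        by (simp add: one_ereal_def)
      with Q have "Q E \<U> < ereal (1 + \<epsilon>)"
        by (rule le_less_trans)
      then obtain \<V> where "\<V> \<in> finite_right_uniform_coverings" "\<U> \<preceq> \<V>" "?N (?J E \<V>) / ?N \<V> < 1 + \<epsilon>"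
        unfolding Q_def Inf_less_iff by auto
      then show "\<exists>\<V>\<in>finite_right_uniform_coverings. \<U> \<preceq> \<V> \<and> ?N (?J E \<V>) \<le> (1 + \<epsilon>) * ?N \<V>"
        using ratio_le_iff less_imp_le by blast
    qed
  next
    assume R: ?R
    show "Q E \<U> \<le> 1"
    proof (rule ereal_le_epsilon2)
      fix \<epsilon> :: real assume "\<epsilon> > 0"
      then obtain \<V> where \<V>: "\<V> \<in> finite_right_uniform_coverings" "\<U> \<preceq> \<V>" "?N (?J E \<V>) \<le> (1 + \<epsilon>) * ?N \<V>"
        using R by blast
      have "Q E \<U> \<le> ereal (?N (?J E \<V>) / ?N \<V>)"
        unfolding Q_def using \<V>(1,2) by (intro Inf_lower) blast
      also have "\<dots> \<le> ereal (1 + \<epsilon>)"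
        using \<V>(1,3) ratio_le_iff by simp
      also have "\<dots> = 1 + ereal \<epsilon>"
        by (simp add: one_ereal_def)
      finally show "Q E \<U> \<le> 1 + ereal \<epsilon>" .
    qed
  qed
  \<comment> \<open>For \<open>E = {0}\<close> all quotients equal \<open>1\<close>.\<close>
  have "1 \<le> (SUP E\<in>{E. finite E}. SUP \<U>\<in>finite_right_uniform_coverings. Q E \<U>)"
  proof -
    have J0: "?J {0} \<V> = \<V>" for \<V>
      by (auto simp: coverings_join_def left_translate_def)
    have "1 \<le> Q {0} {UNIV}"
      unfolding Q_def
    proof (rule Inf_greatest)
      fix r assume "r \<in> {ereal (?N (?J {0} \<V>) / ?N \<V>) | \<V>. \<V> \<in> finite_right_uniform_coverings \<and> {UNIV} \<preceq> \<V>}"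
      then obtain \<V> where "\<V> \<in> finite_right_uniform_coverings" "r = ereal (?N \<V> / ?N \<V>)"
        unfolding J0 by blast
      then show "1 \<le> r"
        using uniform_complexity_pos[of \<V>] by (simp add: one_ereal_def)
    qed
    moreover have "{UNIV} \<in> (finite_right_uniform_coverings :: 'a set set set)"
      by (auto simp: finite_right_uniform_coverings_def right_uniform_covering_iff intro: exI[of _ UNIV])
    ultimately show ?thesis
      by (intro SUP_upper2[of "{0}"] SUP_upper2[of "{UNIV}"]) auto
  qed
  then have "(SUP E\<in>{E. finite E}. SUP \<U>\<in>finite_right_uniform_coverings. Q E \<U>) = 1 \<longleftrightarrow>
      (\<forall>E. finite E \<longrightarrow> (\<forall>\<U>\<in>finite_right_uniform_coverings. Q E \<U> \<le> 1))"
    by (auto simp: SUP_le_iff order_eq_iff)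
  also have "\<dots> \<longleftrightarrow> amenable_group TYPE('a)"
  proof
    assume "\<forall>E. finite E \<longrightarrow> (\<forall>\<U>\<in>finite_right_uniform_coverings. Q E \<U> \<le> 1)"
    then have "almost_invariant_complexity TYPE('a)"
      unfolding Q_le_iff almost_invariant_complexity_def by blast
    then show "amenable_group TYPE('a)"
      by (rule almost_invariant_complexity_imp_amenable)
  next
    assume "amenable_group TYPE('a)"
    then show "\<forall>E. finite E \<longrightarrow> (\<forall>\<U>\<in>finite_right_uniform_coverings. Q E \<U> \<le> 1)"
      unfolding Q_le_iff using amenable_imp_small_ratio[OF assms] by blast
  qed
  finally show ?thesis
    unfolding Q_def by blast
qed

end
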